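(* Let $\Omega\subset\mathbb{R}^{2n}$ be a bounded uniformly convex open set with smooth boundary. For every extendable path $\psi=\{\psi^t\}_{t\in[0,1]}$ of diffeomorphisms of $\partial\Omega$ and every positive path $\phi$ in $\mathrm{Symp}_0(\overline\Omega)$ extending $\psi$, we have $\mathrm{length}_{\mathcal G}(\phi)\le\mathcal{V}(\psi)$. Equality holds if and only if $\phi$ is generated by a uniformly convex Hamiltonian $H$ satisfying the Monge--Amp\`ere equation $\det\nabla^2H_t(z)=c(t)$ for all $(t,z)\in[0,1]\times\overline\Omega$, for some positive numbers $c(t)$.
   Context: $\mathbb{R}^{2n}$ carries $\omega_0=\sum_j\mathrm{d}x_j\wedge\mathrm{d}y_j$ and $J_0$ with $\omega_0(u,v)=J_0u\cdot v$. $\mathrm{Symp}_0(\overline\Omega)$ is the identity component of the symplectomorphism group of $\overline\Omega$. A positive path is $\phi=\{\phi^t_H\}_{t\in[0,1]}$ with $\frac{\mathrm{d}}{\mathrm{d}t}\phi^t_H=J_0\nabla H_t(\phi^t_H)$, $\phi^0_H=\mathrm{id}$, where $H\in C^\infty([0,1]\times\overline\Omega)$, each $H_t$ constant on each leaf of the characteristic foliation of $\partial\Omega$ (tangent to $\ker\omega_0|_{T\partial\Omega}$), and $\nabla^2H_t$ positive definite on $\overline\Omega$ (uniformly convex). $\mathrm{length}_{\mathcal G}(\phi)=\frac{1}{\mathrm{vol}(\Omega)}\int_0^1\int_\Omega(\det\nabla^2H_t(z))^{1/(2n)}\,\mathrm{d}z\,\mathrm{d}t$. A smooth path of diffeomorphisms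 $\psi^t$ of $\partial\Omega$ is extendable if $\psi^t=\phi^t|_{\partial\Omega}$ for some positive path $\phi$ (then $\phi$ extends $\psi$). For such $\psi$, $\mathcal{V}(\psi)=\mathrm{vol}(\Omega)^{-1/(2n)}\int_0^1\mathrm{vol}(\nabla H_t(\Omega))^{1/(2n)}\,\mathrm{d}t$, where $H$ generates any positive path extending $\psi$ (the sets $\nabla H_t(\Omega)$ depend only on $\psi$). *)

theory Defs
  imports "HOL-Analysis.Analysis"
begin

text \<open>Ambient space: R^(2n) is modelled as real^('n + 'n); the coordinate
  indexed by Inl j is x_j and the one indexed by Inr j is y_j.\<close>

definition omega0 :: "real^('n::finite + 'n) \<Rightarrow> real^('n + 'n) \<Rightarrow> real" where
  "omega0 u v = (\<Sum>j\<in>UNIV. u $ Inl j * v $ Inr j - u $ Inr j * v $ Inl j)"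

definition J0 :: "real^('n::finite + 'n) \<Rightarrow> real^('n + 'n)" where
  "J0 u = (\<chi> i. case i of Inl j \<Rightarrow> - u $ Inr j | Inr j \<Rightarrow> u $ Inl j)"

fun Ck_on :: "nat \<Rightarrow> 'a::real_normed_vector set \<Rightarrow> ('a \<Rightarrow> 'b::real_normed_vector) \<Rightarrow> bool" where
  "Ck_on 0 U f = continuous_on U f"
| "Ck_on (Suc k) U f =
     (\<exists>f'. (\<forall>x\<in>U. (f has_derivative f' x) (at x)) \<and> (\<forall>v. Ck_on k U (\<lambda>x. f' x v)))"

definition smooth_on :: "'a::real_normed_vector set \<Rightarrow> ('a \<Rightarrow> 'b::real_normed_vector) \<Rightarrow> bool" where
  "smooth_on U f \<longleftrightarrow> (\<forall>k. Ck_on k U f)"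

definition grad :: "(real^'m::finite \<Rightarrow> real) \<Rightarrow> real^'m \<Rightarrow> real^'m" where
  "grad f z = (\<chi> i. frechet_derivative f (at z) (axis i 1))"

definition hess :: "(real^'m::finite \<Rightarrow> real) \<Rightarrow> real^'m \<Rightarrow> real^'m^'m" where
  "hess f z = matrix (frechet_derivative (grad f) (at z))"

definition pos_def :: "real^'m::finite^'m \<Rightarrow> bool" where
  "pos_def A \<longleftrightarrow> (\<forall>v. v \<noteq> 0 \<longrightarrow> v \<bullet> (A *v v) > 0)"

definition unif_convex_domain :: "(real^'m::finite) set \<Rightarrow> bool" where
  "unif_convex_domain \<Omega> \<longleftrightarrow> open \<Omega> \<and> bounded \<Omega> \<and> convex \<Omega> \<and>
     (\<forall>p\<in>frontier \<Omega>. \<exists>U \<rho>. open U \<and> p \<in> U \<and> smooth_on U \<rho> \<and>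
        (\<forall>x\<in>U. x \<in> \<Omega> \<longleftrightarrow> \<rho> x < 0) \<and> (\<forall>x\<in>U. grad \<rho> x \<noteq> 0) \<and>
        (\<forall>v. v \<noteq> 0 \<and> v \<bullet> grad \<rho> p = 0 \<longrightarrow> v \<bullet> (hess \<rho> p *v v) > 0))"

definition tangent_space :: "'a::real_normed_vector set \<Rightarrow> 'a \<Rightarrow> 'a set" where
  "tangent_space S p = {v. \<exists>\<gamma> e. e > 0 \<and> (\<forall>s\<in>{-e<..<e}. \<gamma> s \<in> S) \<and> \<gamma> 0 = p \<and>
                           (\<gamma> has_vector_derivative v) (at 0)}"

definition char_kernel :: "(real^('n::finite + 'n)) set \<Rightarrow> real^('n + 'n) \<Rightarrow> (real^('n + 'n)) set" where
  "char_kernel S p = {v \<in> tangent_space S p. \<forall>w \<in> tangent_space S p. omega0 v w = 0}"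

definition const_on_char_leaves :: "(real^('n::finite + 'n)) set \<Rightarrow> (real^('n + 'n) \<Rightarrow> real) \<Rightarrow> bool" where
  "const_on_char_leaves \<Omega> h \<longleftrightarrow>
     (\<forall>\<gamma> a b. a \<le> b \<and> (\<forall>s\<in>{a..b}. \<gamma> s \<in> frontier \<Omega> \<and>
        (\<exists>v. (\<gamma> has_vector_derivative v) (at s within {a..b}) \<and> v \<in> char_kernel (frontier \<Omega>) (\<gamma> s)))
      \<longrightarrow> h (\<gamma> a) = h (\<gamma> b))"

definition positive_path :: "(real^('n::finite + 'n)) set \<Rightarrow> (real \<Rightarrow> real^('n + 'n) \<Rightarrow> real^('n + 'n))
     \<Rightarrow> (real \<Rightarrow> real^('n + 'n) \<Rightarrow> real) \<Rightarrow> bool" where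
  "positive_path \<Omega> \<phi> H \<longleftrightarrow>
     (\<exists>W. open W \<and> {0..1} \<times> closure \<Omega> \<subseteq> W \<and> smooth_on W (\<lambda>(t, z). H t z)) \<and>
     (\<forall>t\<in>{0..1}. const_on_char_leaves \<Omega> (H t)) \<and>
     (\<forall>t\<in>{0..1}. \<forall>z\<in>closure \<Omega>. pos_def (hess (H t) z)) \<and>
     (\<forall>z\<in>closure \<Omega>. \<phi> 0 z = z) \<and>
     (\<forall>t\<in>{0..1}. \<forall>z\<in>closure \<Omega>.
        ((\<lambda>s. \<phi> s z) has_vector_derivative J0 (grad (H t) (\<phi> t z))) (at t within {0..1}))"

definition extends_path :: "(real^('n::finite + 'n)) set \<Rightarrow> (real \<Rightarrow> real^('n + 'n) \<Rightarrow> real^('n + 'n))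
     \<Rightarrow> (real \<Rightarrow> real^('n + 'n) \<Rightarrow> real^('n + 'n)) \<Rightarrow> bool" where
  "extends_path \<Omega> \<phi> \<psi> \<longleftrightarrow> (\<forall>t\<in>{0..1}. \<forall>z\<in>frontier \<Omega>. \<phi> t z = \<psi> t z)"

definition extendable :: "(real^('n::finite + 'n)) set \<Rightarrow> (real \<Rightarrow> real^('n + 'n) \<Rightarrow> real^('n + 'n)) \<Rightarrow> bool" where
  "extendable \<Omega> \<psi> \<longleftrightarrow> (\<exists>\<phi> H. positive_path \<Omega> \<phi> H \<and> extends_path \<Omega> \<phi> \<psi>)"

definition lengthG :: "(real^('n::finite + 'n)) set \<Rightarrow> (real \<Rightarrow> real^('n + 'n) \<Rightarrow> real^('n + 'n)) \<Rightarrow> real" where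
  "lengthG \<Omega> \<phi> = (let H = (SOME H. positive_path \<Omega> \<phi> H) in
     (1 / measure lebesgue \<Omega>) *
       integral {0..1} (\<lambda>t. integral \<Omega> (\<lambda>z. det (hess (H t) z) powr (1 / real CARD('n + 'n)))))"

definition volV :: "(real^('n::finite + 'n)) set \<Rightarrow> (real \<Rightarrow> real^('n + 'n) \<Rightarrow> real^('n + 'n)) \<Rightarrow> real" where
  "volV \<Omega> \<psi> = (let H = (SOME H. \<exists>\<phi>. positive_path \<Omega> \<phi> H \<and> extends_path \<Omega> \<phi> \<psi>) in
     measure lebesgue \<Omega> powr (- 1 / real CARD('n + 'n)) *
       integral {0..1} (\<lambda>t. measure lebesgue (grad (H t) ` \<Omega>) powr (1 / real CARD('n + 'n))))"

end

theory Submission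
  imports Defs
begin

text \<open>
  A Hamiltonian that is constant on the characteristic leaves generates a vector field tangent to the
  boundary, with normal component \<open>O(\<bar>\<rho>\<bar>)\<close> for a defining function \<open>\<rho>\<close>; hence the flow preserves the
  interior and the boundary, and, being homotopic to the identity through boundary-preserving maps, it is
  onto. So the path determines \<open>\<nabla>H\<^sub>t\<close> on the closure, and its boundary values determine \<open>\<nabla>H\<^sub>t\<close> on the
  boundary. By convexity the latter determines the gradient image: \<open>y\<close> is missed iff \<open>H\<^sub>t - y \<bullet> z\<close> is
  minimal at a boundary point. The volume of the gradient image is \<open>\<integral> det \<nabla>\<^sup>2H\<^sub>t\<close>, and Jensen's inequality
  for the power \<open>1 / 2n\<close>, with its equality case, gives the comparison at each time.
\<close>

section \<open>Change of variables for arbitrary finite index types\<close>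

text \<open>\<open>positive_path\<close> says only that every trajectory starting in the closure
  solves the equation and that \<open>H\<close> is smooth near the closure. Invariance of the
  closure, continuity in the initial point and surjectivity have to be proved, and in this order:
  the Lipschitz bound behind continuity is taken over the closure, and continuity feeds the
  topological argument. Since a trajectory might a priori cross the boundary, the bound on the
  normal velocity is established on both sides of it, which is where smoothness of \<open>H\<close>
  beyond the closure enters. Surjectivity matters because a velocity reveals the gradient only at
  points that the flow reaches. \<open>lengthG\<close> and \<open>volV\<close> pick their
  Hamiltonians by \<open>SOME\<close>, the second one possibly from a different extension of \<psi>.
  Two uniqueness statements remove these choices: the Hessian on \<Omega> is fixed by the path, the
  gradient image by the boundary values. After that, both numbers are expressed through a single
  Hamiltonian and compared at each time.\<close>

definition reindex_cart :: "('b \<Rightarrow> 'a) \<Rightarrow> 'c^'a::finite \<Rightarrow> 'c^'b::finite" where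
  "reindex_cart e x = (\<chi> i. x $ e i)"

lemma reindex_cart_nth [simp]: "reindex_cart e x $ i = x $ e i"
  by (simp add: reindex_cart_def)

lemma reindex_cart_reindex_cart: "reindex_cart e (reindex_cart d x) = reindex_cart (d \<circ> e) x"
  by (simp add: vec_eq_iff)

lemma reindex_cart_id [simp]: "reindex_cart id x = x"
  by (simp add: vec_eq_iff)

lemma reindex_cart_inv [simp]:
  assumes "bij e"
  shows "reindex_cart e (reindex_cart (inv e) x) = x" "reindex_cart (inv e) (reindex_cart e y) = y"
  using assms by (simp_all add: reindex_cart_reindex_cart bij_is_inj bij_is_surj surj_iff[THEN iffD1] inj_iff[THEN iffD1])

lemma inj_reindex_cart: "bij e \<Longrightarrow> inj (reindex_cart e)"
  by (metis injI reindex_cart_inv(2))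

lemma linear_reindex_cart: "linear (reindex_cart e :: real^'a::finite \<Rightarrow> real^'b::finite)"
  by (rule linearI) (simp_all add: vec_eq_iff)

lemma norm_reindex_cart:
  fixes e :: "'b::finite \<Rightarrow> 'a::finite" and x :: "real^'a"
  assumes "bij e"
  shows "norm (reindex_cart e x) = norm x"
proof -
  have "(\<Sum>i\<in>UNIV. (x $ e i)\<^sup>2) = (\<Sum>i\<in>UNIV. (x $ i)\<^sup>2)"
    by (rule sum.reindex_bij_betw[OF assms])
  then show ?thesis
    by (simp add: norm_vec_def L2_set_def)
qed

lemma reindex_cart_image_cbox:
  fixes e :: "'b::finite \<Rightarrow> 'a::finite" and u v :: "real^'a"
  assumes "bij e"
  shows "reindex_cart e ` cbox u v = cbox (reindex_cart e u) (reindex_cart e v)"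
proof (intro equalityI subsetI)
  fix y assume "y \<in> cbox (reindex_cart e u) (reindex_cart e v)"
  moreover have "\<exists>i. e i = j" for j
    using assms by (metis bij_pointE)
  ultimately have "reindex_cart (inv e) y \<in> cbox u v"
    using assms by (simp add: mem_box_cart) (metis bij_inv_eq_iff)
  then have "reindex_cart e (reindex_cart (inv e) y) \<in> reindex_cart e ` cbox u v"
    by (rule imageI)
  then show "y \<in> reindex_cart e ` cbox u v"
    using assms by simp
qed (auto simp: mem_box_cart)

lemma content_reindex_cart_image_cbox:
  fixes e :: "'b::finite \<Rightarrow> 'a::finite" and u v :: "real^'a"
  assumes "bij e"
  shows "measure lborel (reindex_cart e ` cbox u v) = measure lborel (cbox u v)"
proof (cases "cbox u v = {}")
  case False
  then have ne: "cbox (reindex_cart e u) (reindex_cart e v) \<noteq> {}"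
    using reindex_cart_image_cbox[OF assms, of u v] by auto
  have "(\<Prod>i\<in>UNIV. v $ e i - u $ e i) = (\<Prod>i\<in>UNIV. v $ i - u $ i)"
    by (rule prod.reindex_bij_betw[OF assms])
  then show ?thesis
    using False ne by (simp add: reindex_cart_image_cbox[OF assms] content_cbox_cart)
qed auto

text \<open>A relabelling of coordinates carries boxes to boxes of equal content, so the
  transformation rule for boxes applies with factor 1. It is also an isometry, so the radius
  \<open>B\<close> beyond which boxes give good approximations is the same on both sides.\<close>

lemma has_integral_reindex_cart:
  fixes e :: "'b::finite \<Rightarrow> 'a::finite" and f :: "real^'b \<Rightarrow> real"
  assumes e: "bij e" and f: "(f has_integral i) (reindex_cart e ` S)"
  shows "((\<lambda>x. f (reindex_cart e x)) has_integral i) S"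
proof (rule has_integral'[THEN iffD2], intro allI impI)
  fix r :: real assume "0 < r"
  let ?T = "reindex_cart e :: real^'a \<Rightarrow> real^'b" and ?T' = "reindex_cart (inv e) :: real^'b \<Rightarrow> real^'a"
  have e': "bij (inv e)"
    using e by (rule bij_imp_bij_inv)
  obtain B where "B > 0" and B: "\<And>a b. ball 0 B \<subseteq> cbox a b \<Longrightarrow>
      \<exists>z. ((\<lambda>x. if x \<in> ?T ` S then f x else 0) has_integral z) (cbox a b) \<and> norm (z - i) < r"
    using f[THEN has_integral'[THEN iffD1]] \<open>0 < r\<close> by meson
  have "\<exists>z. ((\<lambda>x. if x \<in> S then f (?T x) else 0) has_integral z) (cbox a b) \<and> norm (z - i) < r"
    if ab: "ball 0 B \<subseteq> cbox a b" for a b :: "real^'a"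
  proof -
    have "ball 0 B \<subseteq> cbox (?T a) (?T b)"
    proof
      fix y :: "real^'b" assume "y \<in> ball 0 B"
      then have "?T' y \<in> ball 0 B"
        by (simp add: norm_reindex_cart e')
      then have "?T (?T' y) \<in> ?T ` cbox a b"
        using ab by blast
      then show "y \<in> cbox (?T a) (?T b)"
        using e by (simp add: reindex_cart_image_cbox)
    qed
    then obtain z where z: "((\<lambda>x. if x \<in> ?T ` S then f x else 0) has_integral z) (cbox (?T a) (?T b))"
        and "norm (z - i) < r"
      using B by blast
    have "((\<lambda>x. if ?T x \<in> ?T ` S then f (?T x) else 0) has_integral (1 / 1) *\<^sub>R z) (?T' ` cbox (?T a) (?T b))"
    proof (rule has_integral_twiddle[OF _ _ _ _ _ _ _ z])
      show "continuous (at x) ?T" for x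
        by (simp add: linear_continuous_at linear_reindex_cart linear_conv_bounded_linear[symmetric])
      show "\<exists>w z. ?T ` cbox u v = cbox w z" "\<exists>w z. ?T' ` cbox u' v' = cbox w z" for u v u' v'
        using reindex_cart_image_cbox[OF e] reindex_cart_image_cbox[OF e'] by blast+
      show "measure lborel (?T ` cbox u v) = 1 * measure lborel (cbox u v)" for u v
        by (simp add: content_reindex_cart_image_cbox[OF e])
    qed (use e in auto)
    moreover have "?T x \<in> ?T ` S \<longleftrightarrow> x \<in> S" for x
      using inj_reindex_cart[OF e] by (rule inj_image_mem_iff)
    ultimately have "((\<lambda>x. if x \<in> S then f (?T x) else 0) has_integral z) (cbox a b)"
      using e e' by (simp add: reindex_cart_image_cbox)
    with \<open>norm (z - i) < r\<close> show ?thesis by blast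
  qed
  with \<open>B > 0\<close> show "\<exists>B>0. \<forall>a b. ball 0 B \<subseteq> cbox a b \<longrightarrow>
      (\<exists>z. ((\<lambda>x. if x \<in> S then f (?T x) else 0) has_integral z) (cbox a b) \<and> norm (z - i) < r)"
    by blast
qed

text \<open>Conjugation by \<open>e\<close> is a sign-preserving bijection between the two symmetric
  groups, and it matches the Leibniz expansions term by term.\<close>

lemma det_reindex:
  fixes e :: "'b::finite \<Rightarrow> 'a::finite" and A :: "real^'a^'a"
  assumes e: "bij e"
  shows "det (\<chi> i j. A $ e i $ e j) = det A"
proof -
  let ?m = "map_permutation UNIV e"
  have inje: "inj e" and e': "bij (inv e)"
    using e by (simp_all add: bij_is_inj bij_imp_bij_inv)
  have bij: "bij_betw ?m {p. p permutes UNIV} {p. p permutes UNIV}"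
  proof (rule bij_betw_byWitness[where f'="map_permutation UNIV (inv e)"])
    show "\<forall>p\<in>{p. p permutes UNIV}. map_permutation UNIV (inv e) (?m p) = p"
      using e by (auto intro!: map_permutation_compose_inv[where B=UNIV] simp: bij_is_inj)
    show "\<forall>p\<in>{p. p permutes UNIV}. ?m (map_permutation UNIV (inv e) p) = p"
      using e e' by (auto intro!: map_permutation_compose_inv[where B=UNIV] simp: bij_is_surj surj_f_inv_f)
    show "?m ` {p. p permutes UNIV} \<subseteq> {p. p permutes UNIV}"
      using e by (auto intro: map_permutation_permutes)
    show "map_permutation UNIV (inv e) ` {p. p permutes UNIV} \<subseteq> {p. p permutes UNIV}"
      using e' by (auto intro: map_permutation_permutes)
  qed
  have "det A = (\<Sum>p | p permutes UNIV. of_int (sign (?m p)) * (\<Prod>i\<in>UNIV. A $ i $ ?m p i))"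
    unfolding det_def by (rule sum.reindex_bij_betw[OF bij, symmetric])
  also have "\<dots> = (\<Sum>p | p permutes UNIV. of_int (sign p) * (\<Prod>i\<in>UNIV. A $ e i $ e (p i)))"
  proof (rule sum.cong[OF refl])
    fix p :: "'b \<Rightarrow> 'b" assume "p \<in> {p. p permutes UNIV}"
    then have p: "p permutes UNIV" by simp
    have "sign (?m p) = sign p"
      by (rule sign_map_permutation) (use p inje in auto)
    moreover have "(\<Prod>i\<in>UNIV. A $ i $ ?m p i) = (\<Prod>i\<in>UNIV. A $ e i $ ?m p (e i))"
      by (rule prod.reindex_bij_betw[OF e, symmetric])
    ultimately show "of_int (sign (?m p)) * (\<Prod>i\<in>UNIV. A $ i $ ?m p i)
        = of_int (sign p) * (\<Prod>i\<in>UNIV. A $ e i $ e (p i))"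
      by (simp add: map_permutation_apply[OF inje])
  qed
  finally show ?thesis
    by (simp add: det_def)
qed

text \<open>The change of variables theorem of the library needs a well-ordered index type;
  relabelling the coordinates removes this restriction.\<close>

lemma measure_differentiable_image_eq_reindex:
  fixes e :: "'b::{finite,wellorder} \<Rightarrow> 'a::finite" and f :: "real^'a \<Rightarrow> real^'a"
  assumes e: "bij e" and S: "open S"
    and der: "\<And>x. x \<in> S \<Longrightarrow> (f has_derivative f' x) (at x)"
    and inj: "inj_on f S"
    and int: "(\<lambda>x. \<bar>det (matrix (f' x))\<bar>) integrable_on S"
  shows "measure lebesgue (f ` S) = integral S (\<lambda>x. \<bar>det (matrix (f' x))\<bar>)"
proof -
  let ?T = "reindex_cart e :: real^'a \<Rightarrow> real^'b::_" and ?T' = "reindex_cart (inv e) :: real^'b::_ \<Rightarrow> real^'a"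
  let ?g = "\<lambda>y. ?T (f (?T' y))" and ?g' = "\<lambda>y v. ?T (f' (?T' y) (?T' v))"
  have e': "bij (inv e)"
    using e by (rule bij_imp_bij_inv)
  have blT: "bounded_linear ?T" "bounded_linear ?T'"
    by (simp_all add: linear_reindex_cart linear_conv_bounded_linear[symmetric])
  have TS: "?T ` S = ?T' -` S"
    using e by (auto simp: image_iff) (metis reindex_cart_inv(1))
  have op: "open (?T ` S)"
    unfolding TS using S blT(2) by (intro open_vimage linear_continuous_on)
  have T'T: "?T' ` (?T ` S) = S"
    using e by (simp add: image_image)
  have der_g: "(?g has_derivative ?g' y) (at y within ?T ` S)" if "y \<in> ?T ` S" for y
  proof -
    have "?T' y \<in> S" using that TS by auto
    then have "((\<lambda>y. f (?T' y)) has_derivative (\<lambda>v. f' (?T' y) (?T' v))) (at y)"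
      using has_derivative_compose[OF bounded_linear_imp_has_derivative[OF blT(2)] der] by blast
    then have "(?g has_derivative ?g' y) (at y)"
      by (rule bounded_linear.has_derivative[OF blT(1)])
    then show ?thesis by (rule has_derivative_at_withinI)
  qed
  have inj_g: "inj_on ?g (?T ` S)"
    using inj e by (auto simp: inj_on_def) (metis reindex_cart_inv(2))
  have det: "det (matrix (?g' y)) = det (matrix (f' (?T' y)))" if "y \<in> ?T ` S" for y
  proof -
    \<comment> \<open>Conjugating the map by the relabelling permutes rows and columns of its
      Jacobian by the same bijection, so \<open>det_reindex\<close> applies.\<close>
    have "?T' (axis j 1) = axis (e j) 1" for j
      by (simp add: vec_eq_iff axis_def) (metis bij_inv_eq_iff[OF e])
    then have "matrix (?g' y) = (\<chi> i j. matrix (f' (?T' y)) $ e i $ e j)"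
      by (simp add: matrix_def vec_eq_iff[of "vec_lambda _"])
    then show ?thesis
      using det_reindex[OF e] by simp
  qed
  define m where "m = integral S (\<lambda>x. \<bar>det (matrix (f' x))\<bar>)"
  have "((\<lambda>x. \<bar>det (matrix (f' x))\<bar>) has_integral m) (?T' ` (?T ` S))"
    using int by (simp add: m_def has_integral_iff T'T)
  from has_integral_reindex_cart[OF e' this]
  have "((\<lambda>y. \<bar>det (matrix (?g' y))\<bar>) has_integral m) (?T ` S)"
    using det by (subst has_integral_cong[where g="\<lambda>y. \<bar>det (matrix (f' (?T' y)))\<bar>"]) auto
  then have "?g ` (?T ` S) \<in> lmeasurable \<and> measure lebesgue (?g ` (?T ` S)) = m"
    using has_measure_differentiable_image[OF _ der_g inj_g] op by (metis (no_types, lifting) borel_open sets_completionI_sets sets_lborel)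
  moreover have "?g ` (?T ` S) = ?T ` (f ` S)"
    using e by (simp add: image_image)
  \<comment> \<open>A measure is the integral of the constant 1, so the measure of the image travels
    back to the original index type by the same rule as the integral.\<close>
  ultimately have "((\<lambda>y. 1::real) has_integral m) (?T ` (f ` S))"
    by (metis lmeasurable_iff_integrable_on lmeasure_integral has_integral_iff)
  from has_integral_reindex_cart[OF e this]
  have "((\<lambda>y. 1::real) has_integral m) (f ` S)" .
  then show ?thesis
    using m_def by (metis lmeasurable_iff_integrable_on lmeasure_integral has_integral_iff)
qed

section \<open>Gradients and Hessians of smooth functions\<close>

lemma has_derivative_vec_componentwise:
  fixes f :: "'a::real_normed_vector \<Rightarrow> real^'m::finite"
  assumes "\<And>i. ((\<lambda>x. f x $ i) has_derivative (\<lambda>v. f' v $ i)) (at x)"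
  shows "(f has_derivative f') (at x)"
  using assms by (subst has_derivative_componentwise_within) (auto simp: Basis_vec_def inner_axis)

lemma linear_eq_inner_axis:
  fixes l :: "real^'m::finite \<Rightarrow> real"
  assumes "linear l"
  shows "l v = (\<chi> i. l (axis i 1)) \<bullet> v"
proof -
  have "l v = l (\<Sum>i\<in>UNIV. v $ i *\<^sub>R axis i 1)"
    using basis_expansion[of v] by (simp add: scalar_mult_eq_scaleR)
  also have "\<dots> = (\<Sum>i\<in>UNIV. v $ i * l (axis i 1))"
    using assms by (simp add: linear_sum linear_scale)
  finally show ?thesis
    by (simp add: inner_vec_def mult.commute)
qed

text \<open>The entries of \<open>G\<close> and \<open>A\<close> are derivatives of \<open>F\<close>
  in the directions \<open>L (axis i 1)\<close>, so they depend on the linear part \<open>L\<close>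
  alone and can be fixed before the affine map \<open>j\<close>. With \<open>L\<close> the identity
  this describes a single function; with \<open>L v = (0, v)\<close> it treats all slices of a
  time-dependent function at once and yields continuity jointly in time and space.\<close>

lemma C2_affine_pullback:
  fixes F :: "'a::real_normed_vector \<Rightarrow> real" and L :: "real^'m::finite \<Rightarrow> 'a"
  assumes W: "open W" and F: "Ck_on (Suc (Suc 0)) W F" and L: "bounded_linear L"
  obtains G :: "'a \<Rightarrow> real^'m" and A :: "'a \<Rightarrow> real^'m^'m"
  where "continuous_on W G" "continuous_on W A"
    "\<And>j z. (\<And>z. (j has_derivative L) (at z)) \<Longrightarrow> j z \<in> W \<Longrightarrow>
       grad (\<lambda>z. F (j z)) z = G (j z) \<and> hess (\<lambda>z. F (j z)) z = A (j z) \<and>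
       ((\<lambda>z. F (j z)) has_derivative (\<lambda>v. G (j z) \<bullet> v)) (at z) \<and>
       (grad (\<lambda>z. F (j z)) has_derivative (\<lambda>v. A (j z) *v v)) (at z)"
proof -
  obtain F' where F': "\<And>x. x \<in> W \<Longrightarrow> (F has_derivative F' x) (at x)"
      and "\<forall>v. Ck_on (Suc 0) W (\<lambda>x. F' x v)"
    using F by auto
  then have "\<forall>v. \<exists>D. (\<forall>x\<in>W. ((\<lambda>x. F' x v) has_derivative D x) (at x)) \<and> (\<forall>w. continuous_on W (\<lambda>x. D x w))"
    by simp
  then obtain D where D: "\<And>v x. x \<in> W \<Longrightarrow> ((\<lambda>x. F' x v) has_derivative D v x) (at x)"
      and contD: "\<And>v w. continuous_on W (\<lambda>x. D v x w)"
    by metis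
  define G :: "'a \<Rightarrow> real^'m" where "G x = (\<chi> i. F' x (L (axis i 1)))" for x
  define A :: "'a \<Rightarrow> real^'m^'m" where "A x = (\<chi> i k. D (L (axis i 1)) x (L (axis k 1)))" for x
  have contF': "continuous_on W (\<lambda>x. F' x v)" for v
    by (rule has_derivative_continuous_on[where f'="D v"]) (rule has_derivative_at_withinI[OF D])
  have contG: "continuous_on W G"
    unfolding G_def by (intro continuous_on_vec_lambda contF')
  have contA: "continuous_on W A"
    unfolding A_def by (intro continuous_on_vec_lambda contD)
  show thesis
  proof (rule that[OF contG contA])
    fix j :: "real^'m \<Rightarrow> 'a" and z
    assume j: "\<And>z. (j has_derivative L) (at z)" and z: "j z \<in> W"
    let ?f = "\<lambda>z. F (j z)"
    have der: "(?f has_derivative (\<lambda>v. G (j z) \<bullet> v)) (at z)" if "j z \<in> W" for z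
    proof -
      have "(?f has_derivative (\<lambda>v. F' (j z) (L v))) (at z)"
        using has_derivative_compose[OF j F'[OF that]] .
      moreover from has_derivative_linear[OF this] have "F' (j z) (L v) = G (j z) \<bullet> v" for v
        unfolding G_def by (rule linear_eq_inner_axis)
      ultimately show ?thesis
        by simp
    qed
    have grad: "grad ?f z = G (j z)" if "j z \<in> W" for z
      using frechet_derivative_at[OF der[OF that], symmetric]
      by (simp add: grad_def inner_axis vec_eq_iff)
    have "((\<lambda>z. G (j z)) has_derivative (\<lambda>v. A (j z) *v v)) (at z)"
    proof (rule has_derivative_vec_componentwise)
      fix i
      have "((\<lambda>z. F' (j z) (L (axis i 1))) has_derivative (\<lambda>v. D (L (axis i 1)) (j z) (L v))) (at z)"
        using has_derivative_compose[OF j D[OF z]] .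
      moreover have "D (L (axis i 1)) (j z) (L v) = (A (j z) *v v) $ i" for v
        using linear_eq_inner_axis[OF has_derivative_linear[OF calculation], of v]
        by (simp add: A_def matrix_vector_mult_def inner_vec_def)
      ultimately show "((\<lambda>z. G (j z) $ i) has_derivative (\<lambda>v. (A (j z) *v v) $ i)) (at z)"
        by (simp add: G_def)
    qed
    \<comment> \<open>The Hessian differentiates the gradient, so the formula for the gradient must
      hold on a whole neighbourhood of \<open>z\<close>.\<close>
    moreover have "open (j -` W)"
      using W continuous_at_imp_continuous_on[of UNIV j] has_derivative_continuous[OF j]
      by (auto intro: open_vimage)
    ultimately have der2: "(grad ?f has_derivative (\<lambda>v. A (j z) *v v)) (at z)"
      by (rule has_derivative_transform_within_open) (use z grad in auto)
    have "hess ?f z = A (j z)"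
      using frechet_derivative_at[OF der2, symmetric] by (simp add: hess_def)
    then show "grad ?f z = G (j z) \<and> hess ?f z = A (j z) \<and>
        (?f has_derivative (\<lambda>v. G (j z) \<bullet> v)) (at z) \<and>
        (grad ?f has_derivative (\<lambda>v. A (j z) *v v)) (at z)"
      using der grad der2 z by blast
  qed
qed

lemma smooth_on_grad_hess:
  fixes f :: "real^'m::finite \<Rightarrow> real"
  assumes "open U" "smooth_on U f"
  shows "\<And>z. z \<in> U \<Longrightarrow> (f has_derivative (\<lambda>v. grad f z \<bullet> v)) (at z)"
    and "\<And>z. z \<in> U \<Longrightarrow> (grad f has_derivative (\<lambda>v. hess f z *v v)) (at z)"
    and "continuous_on U (grad f)" and "continuous_on U (hess f)"
proof -
  have "Ck_on (Suc (Suc 0)) U f"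
    using assms(2) by (simp only: smooth_on_def)
  from C2_affine_pullback[OF assms(1) this bounded_linear_ident]
  obtain G A where c: "continuous_on U G" "continuous_on U A"
    and pb: "\<And>j z. (\<And>z. (j has_derivative (\<lambda>v. v)) (at z)) \<Longrightarrow> j z \<in> U \<Longrightarrow>
       grad (\<lambda>z. f (j z)) z = G (j z) \<and> hess (\<lambda>z. f (j z)) z = A (j z) \<and>
       ((\<lambda>z. f (j z)) has_derivative (\<lambda>v. G (j z) \<bullet> v)) (at z) \<and>
       (grad (\<lambda>z. f (j z)) has_derivative (\<lambda>v. A (j z) *v v)) (at z)"
    by blast
  have *: "grad f z = G z \<and> hess f z = A z \<and>
       (f has_derivative (\<lambda>v. G z \<bullet> v)) (at z) \<and> (grad f has_derivative (\<lambda>v. A z *v v)) (at z)"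
    if "z \<in> U" for z
    using pb[of "\<lambda>z. z", OF has_derivative_ident that] by (simp add: eta_contract_eq)
  show "z \<in> U \<Longrightarrow> (f has_derivative (\<lambda>v. grad f z \<bullet> v)) (at z)"
    "z \<in> U \<Longrightarrow> (grad f has_derivative (\<lambda>v. hess f z *v v)) (at z)" for z
    using *[of z] by auto
  show "continuous_on U (grad f)" "continuous_on U (hess f)"
    using c * by (simp_all cong: continuous_on_cong)
qed

lemma smooth_on_family_grad_hess:
  fixes H :: "real \<Rightarrow> real^'m::finite \<Rightarrow> real"
  assumes "open W" "smooth_on W (\<lambda>(t, z). H t z)"
  shows "\<And>t z. (t, z) \<in> W \<Longrightarrow> (H t has_derivative (\<lambda>v. grad (H t) z \<bullet> v)) (at z)"
    and "\<And>t z. (t, z) \<in> W \<Longrightarrow> (grad (H t) has_derivative (\<lambda>v. hess (H t) z *v v)) (at z)"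
    and "continuous_on W (\<lambda>(t, z). grad (H t) z)" and "continuous_on W (\<lambda>(t, z). hess (H t) z)"
proof -
  have C: "Ck_on (Suc (Suc 0)) W (\<lambda>(t, z). H t z)"
    using assms(2) by (simp only: smooth_on_def)
  have "bounded_linear (\<lambda>v::real^'m. (0::real, v))"
    by (intro bounded_linear_Pair bounded_linear_zero bounded_linear_ident)
  from C2_affine_pullback[OF assms(1) C this]
  obtain G A where c: "continuous_on W G" "continuous_on W A"
    and pb: "\<And>j z. (\<And>z. (j has_derivative (\<lambda>v::real^'m. (0::real, v))) (at z)) \<Longrightarrow> j z \<in> W \<Longrightarrow>
       grad (\<lambda>z. (\<lambda>(t, z). H t z) (j z)) z = G (j z) \<and> hess (\<lambda>z. (\<lambda>(t, z). H t z) (j z)) z = A (j z) \<and>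
       ((\<lambda>z. (\<lambda>(t, z). H t z) (j z)) has_derivative (\<lambda>v. G (j z) \<bullet> v)) (at z) \<and>
       (grad (\<lambda>z. (\<lambda>(t, z). H t z) (j z)) has_derivative (\<lambda>v. A (j z) *v v)) (at z)"
    by blast
  have *: "grad (H t) z = G (t, z) \<and> hess (H t) z = A (t, z) \<and>
       (H t has_derivative (\<lambda>v. G (t, z) \<bullet> v)) (at z) \<and> (grad (H t) has_derivative (\<lambda>v. A (t, z) *v v)) (at z)"
    if "(t, z) \<in> W" for t z
  proof -
    have "((\<lambda>z::real^'m. (t, z)) has_derivative (\<lambda>v. (0, v))) (at z)" for z
      by (intro has_derivative_Pair has_derivative_const has_derivative_ident)
    from pb[OF this that] show ?thesis
      by (simp add: eta_contract_eq)
  qed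
  show "(t, z) \<in> W \<Longrightarrow> (H t has_derivative (\<lambda>v. grad (H t) z \<bullet> v)) (at z)"
    "(t, z) \<in> W \<Longrightarrow> (grad (H t) has_derivative (\<lambda>v. hess (H t) z *v v)) (at z)" for t z
    using *[of t z] by auto
  have "(case p of (t, z) \<Rightarrow> grad (H t) z) = G p" "(case p of (t, z) \<Rightarrow> hess (H t) z) = A p" if "p \<in> W" for p
    using that * by (cases p; auto)+
  then show "continuous_on W (\<lambda>(t, z). grad (H t) z)" "continuous_on W (\<lambda>(t, z). hess (H t) z)"
    using c by (simp_all cong: continuous_on_cong)
qed

section \<open>Gronwall and Picard\<close>

text \<open>The function \<open>exp (K * t) * (u t \<bullet> u t)\<close> is nonincreasing for
  \<open>K = - 2 * C\<close> and nondecreasing for \<open>K = 2 * C\<close>, which covers times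
  after and before \<open>s\<close>. Both directions matter: a zero at one time then forces
  \<open>u\<close> to vanish on the whole interval. The bound also gives Lipschitz dependence of the
  flow on the initial point.\<close>

lemma gronwall_norm:
  fixes u :: "real \<Rightarrow> 'a::real_inner"
  assumes der: "\<And>t. t \<in> {a..b} \<Longrightarrow> (u has_vector_derivative u' t) (at t within {a..b})"
    and bound: "\<And>t. t \<in> {a..b} \<Longrightarrow> norm (u' t) \<le> C * norm (u t)"
    and s: "s \<in> {a..b}" and t: "t \<in> {a..b}"
  shows "norm (u t) \<le> exp (C * \<bar>t - s\<bar>) * norm (u s)"
proof -
  define h where "h K t = exp (K * t) * (u t \<bullet> u t)" for K t
  define h' where "h' K t = exp (K * t) * (K * (u t \<bullet> u t) + 2 * (u t \<bullet> u' t))" for K t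
  have der_h: "(h K has_derivative (\<lambda>v. v * h' K t)) (at t within {a..b})" if "t \<in> {a..b}" for K t
    using der[OF that] unfolding h_def h'_def has_vector_derivative_def
    by (auto intro!: derivative_eq_intros simp: algebra_simps inner_commute)
  have inner_le: "\<bar>u t \<bullet> u' t\<bar> \<le> C * (u t \<bullet> u t)" if "t \<in> {a..b}" for t
  proof -
    have "\<bar>u t \<bullet> u' t\<bar> \<le> norm (u t) * norm (u' t)"
      by (rule Cauchy_Schwarz_ineq2)
    also have "\<dots> \<le> norm (u t) * (C * norm (u t))"
      using bound[OF that] by (intro mult_left_mono) auto
    finally show ?thesis
      by (simp add: dot_square_norm power2_eq_square algebra_simps)
  qed
  have mvt: "\<exists>\<xi>\<in>{a..b}. h K y - h K x = (y - x) * h' K \<xi>" if "x \<in> {a..b}" "y \<in> {a..b}" "x < y" for K x y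
  proof -
    have "\<exists>\<xi>\<in>{x<..<y}. h K y - h K x = (y - x) * h' K \<xi>"
      using that by (intro mvt_simple has_derivative_subset[OF der_h]) auto
    with that show ?thesis by auto
  qed
  have "exp (- 2 * C * \<bar>t - s\<bar>) * (u t \<bullet> u t) \<le> u s \<bullet> u s"
  proof (cases rule: linorder_cases[of s t])
    case less
    have "h' (- 2 * C) \<xi> \<le> 0" if "\<xi> \<in> {a..b}" for \<xi>
      using inner_le[OF that] by (auto simp: h'_def mult_le_0_iff)
    with mvt[OF s t less, of "- 2 * C"] less have "h (- 2 * C) t \<le> h (- 2 * C) s"
      by (smt (verit) mult_nonneg_nonpos)
    then have "exp (2 * C * s) * h (- 2 * C) t \<le> exp (2 * C * s) * h (- 2 * C) s"
      by simp
    moreover have "exp (2 * C * s) * exp (- 2 * C * t) = exp (- 2 * C * \<bar>t - s\<bar>)"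
      using less by (simp flip: exp_add add: algebra_simps)
    moreover have "exp (2 * C * s) * exp (- 2 * C * s) = 1"
      by (simp flip: exp_add)
    ultimately show ?thesis
      by (simp only: h_def mult.assoc[symmetric] mult_1)
  next
    case greater
    have "h' (2 * C) \<xi> \<ge> 0" if "\<xi> \<in> {a..b}" for \<xi>
      using inner_le[OF that] by (auto simp: h'_def)
    with mvt[OF t s greater, of "2 * C"] greater have "h (2 * C) t \<le> h (2 * C) s"
      by (smt (verit) mult_nonneg_nonneg)
    then have "exp (- 2 * C * s) * h (2 * C) t \<le> exp (- 2 * C * s) * h (2 * C) s"
      by simp
    moreover have "exp (- 2 * C * s) * exp (2 * C * t) = exp (- 2 * C * \<bar>t - s\<bar>)"
      using greater by (simp flip: exp_add add: algebra_simps)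
    moreover have "exp (- 2 * C * s) * exp (2 * C * s) = 1"
      by (simp flip: exp_add)
    ultimately show ?thesis
      by (simp only: h_def mult.assoc[symmetric] mult_1)
  qed simp
  then have "exp (2 * C * \<bar>t - s\<bar>) * (exp (- 2 * C * \<bar>t - s\<bar>) * (u t \<bullet> u t)) \<le> exp (2 * C * \<bar>t - s\<bar>) * (u s \<bullet> u s)"
    by simp
  then have "u t \<bullet> u t \<le> exp (2 * C * \<bar>t - s\<bar>) * (u s \<bullet> u s)"
    by (simp add: mult.assoc[symmetric] flip: exp_add)
  also have "exp (2 * C * \<bar>t - s\<bar>) = (exp (C * \<bar>t - s\<bar>))\<^sup>2"
    by (simp add: mult.assoc flip: exp_double)
  finally have "(norm (u t))\<^sup>2 \<le> (exp (C * \<bar>t - s\<bar>) * norm (u s))\<^sup>2"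
    by (simp add: dot_square_norm power_mult_distrib)
  then show ?thesis
    by (rule power2_le_imp_le) simp
qed

lemma norm_integral_diff_le:
  fixes q :: "real \<Rightarrow> 'a::euclidean_space"
  assumes q: "continuous_on {a..b} q" and bound: "\<And>t. t \<in> {a..b} \<Longrightarrow> norm (q t) \<le> B"
    and "x \<in> {a..b}" "y \<in> {a..b}"
  shows "norm (integral {a..y} q - integral {a..x} q) \<le> B * \<bar>y - x\<bar>"
proof -
  have *: "norm (integral {a..y} q - integral {a..x} q) \<le> B * (y - x)"
    if "x \<in> {a..b}" "y \<in> {a..b}" "x \<le> y" for x y
  proof -
    have "q integrable_on {a..y}"
      using q that by (intro integrable_continuous_interval) (auto intro: continuous_on_subset)
    then have "integral {a..y} q - integral {a..x} q = integral {x..y} q"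
      using that Henstock_Kurzweil_Integration.integral_combine[of a x y q] by (simp add: algebra_simps)
    moreover have "norm (integral {x..y} q) \<le> B * (y - x)"
      using that bound q by (intro integral_bound) (auto intro: continuous_on_subset)
    ultimately show ?thesis by simp
  qed
  show ?thesis
    using *[of x y] *[of y x] assms by (cases "x \<le> y") (auto simp: norm_minus_commute)
qed

text \<open>Constancy on characteristic leaves is a statement about given curves, so a
  characteristic curve through a boundary point has to be produced. Composing \<open>F\<close> with
  the nearest-point projection onto the ball makes it bounded and globally Lipschitz; the Picard
  operator is then a contraction on all bounded continuous functions, and for short times its fixed
  point stays in the ball, where the modified field is \<open>F\<close>.\<close>

theorem picard_local_solution:
  fixes F :: "'a::euclidean_space \<Rightarrow> 'a"
  assumes r: "r > 0"
    and lip: "\<And>x y. x \<in> cball p r \<Longrightarrow> y \<in> cball p r \<Longrightarrow> norm (F x - F y) \<le> L * norm (x - y)"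
  obtains \<gamma> h where "h > 0" "\<gamma> 0 = p" "\<And>s. s \<in> {-h..h} \<Longrightarrow> \<gamma> s \<in> cball p r"
    "\<And>s. s \<in> {-h..h} \<Longrightarrow> (\<gamma> has_vector_derivative F (\<gamma> s)) (at s within {-h..h})"
proof -
  let ?c = "closest_point (cball p r)"
  define F0 where "F0 = (\<lambda>x. F (?c x))"
  define K where "K = max L 0"
  have K: "K \<ge> 0" by (simp add: K_def)
  have c_in: "?c x \<in> cball p r" for x
    using r by (intro closest_point_in_set) auto
  have lip0: "norm (F0 x - F0 y) \<le> K * norm (x - y)" for x y
  proof -
    have "norm (F0 x - F0 y) \<le> L * norm (?c x - ?c y)"
      unfolding F0_def by (intro lip c_in)
    also have "\<dots> \<le> K * norm (?c x - ?c y)"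
      by (intro mult_right_mono) (auto simp: K_def)
    also have "\<dots> \<le> K * norm (x - y)"
      using closest_point_lipschitz[of "cball p r" x y] r K
      by (intro mult_left_mono) (auto simp: dist_norm)
    finally show ?thesis .
  qed
  have cont0: "continuous_on S F0" for S
    using lip0 K by (intro lipschitz_on_continuous_on[of K] lipschitz_onI) (auto simp: dist_norm)
  define M where "M = norm (F p) + K * r"
  have M: "M \<ge> 0" using K r by (simp add: M_def)
  have bound0: "norm (F0 x) \<le> M" for x
  proof -
    have "norm (F0 x) \<le> norm (F p) + norm (F (?c x) - F p)"
      unfolding F0_def by (metis norm_triangle_sub)
    also have "norm (F (?c x) - F p) \<le> L * norm (?c x - p)"
      using r by (intro lip c_in) auto
    also have "\<dots> \<le> K * r"
      using c_in[of x] by (intro mult_mono) (auto simp: K_def dist_norm norm_minus_commute)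
    finally show ?thesis by (simp add: M_def)
  qed
  \<comment> \<open>The first bound keeps the solution within distance \<open>r\<close> of
    \<open>p\<close>, the second makes the operator a contraction with factor 1/2; the added 1 keeps
    the denominators positive.\<close>
  define h where "h = min (r / (M + 1)) (1 / (2 * (K + 1)))"
  have h: "h > 0" "M * h \<le> r" "K * h \<le> 1 / 2"
  proof -
    show "h > 0" using r M K by (simp add: h_def)
    have "M * h \<le> M * (r / (M + 1))"
      using M by (intro mult_left_mono) (auto simp: h_def)
    also have "\<dots> \<le> r" using M r by (simp add: field_simps)
    finally show "M * h \<le> r" .
    have "K * h \<le> K * (1 / (2 * (K + 1)))"
      using K by (intro mult_left_mono) (auto simp: h_def)
    also have "\<dots> \<le> 1 / 2" using K by (simp add: field_simps)
    finally show "K * h \<le> 1 / 2" .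
  qed
  \<comment> \<open>Bounded continuous functions live on the whole line, so time is clamped to the
    interval of existence.\<close>
  define cl where "cl s = max (- h) (min h s)" for s :: real
  have cl: "cl s \<in> {-h..h}" for s using h by (auto simp: cl_def)
  \<comment> \<open>Integrating from \<open>-h\<close> and subtracting the value at 0 later handles
    negative times without oriented integrals.\<close>
  define I where "I f s = integral {-h..s} (\<lambda>\<tau>. F0 (apply_bcontfun f \<tau>))" for f :: "real \<Rightarrow>\<^sub>C 'a" and s
  have contq: "continuous_on S (\<lambda>\<tau>. F0 (apply_bcontfun f \<tau>))" for f :: "real \<Rightarrow>\<^sub>C 'a" and S
    by (rule continuous_on_compose2[OF cont0[of UNIV]]) auto
  have intq: "(\<lambda>\<tau>. F0 (apply_bcontfun f \<tau>)) integrable_on {a..b}" for f :: "real \<Rightarrow>\<^sub>C 'a" and a b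
    by (intro integrable_continuous_interval contq)
  have Ibound: "norm (I f (cl s) - I f 0) \<le> M * \<bar>cl s\<bar>" for f s
    using norm_integral_diff_le[OF contq, of "-h" h f M 0 "cl s"] bound0 cl[of s] h by (simp add: I_def)
  define \<Phi> where "\<Phi> f = Bcontfun (\<lambda>s. p + (I f (cl s) - I f 0))" for f
  have in_bcf: "(\<lambda>s. p + (I f (cl s) - I f 0)) \<in> bcontfun" for f
  proof (rule bcontfun_normI)
    have "continuous_on {-h..h} (I f)"
      unfolding I_def by (intro indefinite_integral_continuous_1 intq)
    moreover have "continuous_on UNIV cl"
      unfolding cl_def by (intro continuous_intros)
    ultimately have "continuous_on UNIV (\<lambda>s. I f (cl s))"
      using cl by (intro continuous_on_compose2[of "{-h..h}" "I f" UNIV cl]) auto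
    then show "continuous_on UNIV (\<lambda>s. p + (I f (cl s) - I f 0))"
      by (intro continuous_intros)
    show "norm (p + (I f (cl s) - I f 0)) \<le> norm p + M * h" for s
    proof -
      have "M * \<bar>cl s\<bar> \<le> M * h"
        using cl[of s] M by (intro mult_left_mono) auto
      with Ibound[of f s] show ?thesis
        by (smt (verit) norm_triangle_ineq)
    qed
  qed
  have \<Phi>: "apply_bcontfun (\<Phi> f) s = p + (I f (cl s) - I f 0)" for f s
    unfolding \<Phi>_def by (subst Bcontfun_inverse[OF in_bcf]) simp
  have contr: "dist (\<Phi> f) (\<Phi> g) \<le> 1 / 2 * dist f g" for f g
  proof (rule dist_bound)
    fix s
    let ?q = "\<lambda>\<tau>. F0 (apply_bcontfun f \<tau>) - F0 (apply_bcontfun g \<tau>)"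
    have q: "norm (?q \<tau>) \<le> K * dist f g" for \<tau>
    proof -
      have "norm (?q \<tau>) \<le> K * dist (apply_bcontfun f \<tau>) (apply_bcontfun g \<tau>)"
        using lip0 by (simp add: dist_norm)
      also have "\<dots> \<le> K * dist f g"
        using K by (intro mult_left_mono dist_bounded)
      finally show ?thesis .
    qed
    have "continuous_on {-h..h} ?q"
      by (intro continuous_intros contq)
    then have "norm (integral {-h..cl s} ?q - integral {-h..0} ?q) \<le> K * dist f g * \<bar>cl s - 0\<bar>"
      using q cl[of s] h by (intro norm_integral_diff_le[where b=h]) auto
    also have "\<dots> \<le> K * dist f g * h"
      using cl[of s] K by (intro mult_left_mono) auto
    also have "\<dots> = (K * h) * dist f g" by simp
    also have "\<dots> \<le> 1 / 2 * dist f g"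
      using h by (intro mult_right_mono) auto
    finally show "dist (apply_bcontfun (\<Phi> f) s) (apply_bcontfun (\<Phi> g) s) \<le> 1 / 2 * dist f g"
      by (simp add: \<Phi> I_def dist_norm integral_diff[OF intq intq] algebra_simps)
  qed
  obtain f where f: "\<Phi> f = f"
    using banach_fix_type[of "1 / 2" \<Phi>] contr by auto
  have feq: "apply_bcontfun f s = p + (I f s - I f 0)" if "s \<in> {-h..h}" for s
    using \<Phi>[of f s] that by (simp add: f cl_def)
  have ball: "apply_bcontfun f s \<in> cball p r" if "s \<in> {-h..h}" for s
  proof -
    have "cl s = s" using that by (simp add: cl_def)
    then have "norm (I f s - I f 0) \<le> M * \<bar>s\<bar>" using Ibound[of f s] by simp
    also have "\<dots> \<le> M * h" using that M by (intro mult_left_mono) auto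
    finally show ?thesis
      using feq[OF that] h by (simp add: dist_norm norm_minus_commute)
  qed
  show thesis
  proof (rule that[of h "apply_bcontfun f"])
    show "h > 0" by (rule h)
    show "apply_bcontfun f 0 = p" using feq[of 0] h by simp
    fix s assume s: "s \<in> {-h..h}"
    show "apply_bcontfun f s \<in> cball p r" by (rule ball[OF s])
    have "(I f has_vector_derivative F0 (apply_bcontfun f s)) (at s within {-h..h})"
      unfolding I_def by (rule integral_has_vector_derivative[OF contq s])
    then have "((\<lambda>s. p + (I f s - I f 0)) has_vector_derivative F0 (apply_bcontfun f s)) (at s within {-h..h})"
      by (auto intro!: derivative_eq_intros)
    from has_vector_derivative_transform[OF s feq this]
    have "(apply_bcontfun f has_vector_derivative F0 (apply_bcontfun f s)) (at s within {-h..h})"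
      by simp
    then show "(apply_bcontfun f has_vector_derivative F (apply_bcontfun f s)) (at s within {-h..h})"
      using ball[OF s] by (simp add: F0_def closest_point_self)
  qed
qed

section \<open>Lipschitz estimates and the symplectic structure\<close>

lemma J0_nth [simp]: "J0 u $ Inl j = - u $ Inr j" "J0 u $ Inr j = u $ Inl j"
  by (simp_all add: J0_def)

lemma inner_vec_sum_type:
  fixes u v :: "real^('n::finite + 'n)"
  shows "u \<bullet> v = (\<Sum>j\<in>UNIV. u $ Inl j * v $ Inl j) + (\<Sum>j\<in>UNIV. u $ Inr j * v $ Inr j)"
  by (simp add: inner_vec_def UNIV_Plus_UNIV[symmetric] sum.Plus del: UNIV_Plus_UNIV)

lemma J0_inner: "J0 u \<bullet> v = - (u \<bullet> J0 v)"
  by (simp add: inner_vec_sum_type sum_negf)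

lemma J0_inner_self: "u \<bullet> J0 u = 0"
  using J0_inner[of u u] by (simp add: inner_commute)

text \<open>This is why \<open>J0\<close> turns a boundary normal into a characteristic direction:
  the pairing with any tangent vector vanishes.\<close>

lemma omega0_J0: "omega0 (J0 u) v = - (u \<bullet> v)"
  by (simp add: omega0_def inner_vec_sum_type sum_subtractf sum_negf)

lemma linear_J0: "linear J0"
proof (rule linearI)
  show "J0 (u + v) = J0 u + J0 v" for u v :: "real^('n::finite + 'n)"
    unfolding vec_eq_iff by (auto simp: J0_def split: sum.split)
  show "J0 (r *\<^sub>R u) = r *\<^sub>R J0 u" for r and u :: "real^('n::finite + 'n)"
    unfolding vec_eq_iff by (auto simp: J0_def split: sum.split)
qed

lemma J0_J0: "J0 (J0 u) = - u"
  unfolding vec_eq_iff by (auto simp: J0_def split: sum.split)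

lemma norm_J0 [simp]: "norm (J0 u) = norm u"
  by (simp add: norm_eq_sqrt_inner J0_inner J0_J0)

lemma inj_J0: "inj J0"
  by (metis J0_J0 injI neg_equal_iff_equal)

lemma continuous_on_slice:
  assumes "continuous_on (T \<times> K) (\<lambda>(t, z). h t z)" "t \<in> T"
  shows "continuous_on K (h t)"
proof -
  have "continuous_on K (\<lambda>z. (\<lambda>(t, z). h t z) (t, z))"
    by (rule continuous_on_compose2[OF assms(1)])
      (use assms in \<open>auto intro!: continuous_on_Pair continuous_on_const continuous_on_id\<close>)
  then show ?thesis by simp
qed

text \<open>The sum of the row norms is a crude bound for the operator norm, but visibly continuous
  in the matrix, so compactness makes it uniform.\<close>

lemma norm_matrix_vector_mult_le:
  fixes A :: "real^'m::finite^'k::finite"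
  shows "norm (A *v v) \<le> (\<Sum>i\<in>UNIV. norm (A $ i)) * norm v"
proof -
  have "\<bar>(A *v v) $ i\<bar> \<le> norm (A $ i) * norm v" for i
    using Cauchy_Schwarz_ineq2[of "A $ i" v] by (simp add: matrix_vector_mult_def inner_vec_def)
  then have "(\<Sum>i\<in>UNIV. \<bar>(A *v v) $ i\<bar>) \<le> (\<Sum>i\<in>UNIV. norm (A $ i) * norm v)"
    by (intro sum_mono)
  with norm_le_l1_cart[of "A *v v"] show ?thesis
    by (simp add: sum_distrib_right)
qed

lemma uniformly_lipschitz_family:
  fixes g :: "'t::topological_space \<Rightarrow> real^'m::finite \<Rightarrow> real^'k::finite" and A :: "'t \<Rightarrow> real^'m \<Rightarrow> real^'m^'k"
  assumes T: "compact T" and K: "compact K" "convex K"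
    and A: "continuous_on (T \<times> K) (\<lambda>(t, x). A t x)"
    and der: "\<And>t x. t \<in> T \<Longrightarrow> x \<in> K \<Longrightarrow> (g t has_derivative (\<lambda>v. A t x *v v)) (at x)"
  obtains L where "L \<ge> 0" "\<And>t x y. t \<in> T \<Longrightarrow> x \<in> K \<Longrightarrow> y \<in> K \<Longrightarrow> norm (g t x - g t y) \<le> L * norm (x - y)"
proof -
  have "continuous_on (T \<times> K) (\<lambda>p. \<Sum>i\<in>UNIV. norm ((\<lambda>(t, x). A t x) p $ i))"
    using A by (intro continuous_intros)
  then have "bounded ((\<lambda>p. \<Sum>i\<in>UNIV. norm ((\<lambda>(t, x). A t x) p $ i)) ` (T \<times> K))"
    using T K by (intro compact_imp_bounded compact_continuous_image compact_Times)
  then obtain L where "L > 0" and L: "\<And>t x. t \<in> T \<Longrightarrow> x \<in> K \<Longrightarrow> norm (\<Sum>i\<in>UNIV. norm (A t x $ i)) \<le> L"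
    unfolding bounded_pos by (fastforce simp: image_iff)
  have "norm (g t x - g t y) \<le> L * norm (x - y)" if "t \<in> T" "x \<in> K" "y \<in> K" for t x y
  proof (rule differentiable_bound[OF K(2)])
    show "(g t has_derivative (\<lambda>v. A t x *v v)) (at x within K)" if "x \<in> K" for x
      using der[OF \<open>t \<in> T\<close> that] by (rule has_derivative_at_withinI)
    show "onorm (\<lambda>v. A t x *v v) \<le> L" if "x \<in> K" for x
    proof (rule onorm_le)
      fix v
      have "norm (A t x *v v) \<le> (\<Sum>i\<in>UNIV. norm (A t x $ i)) * norm v"
        by (rule norm_matrix_vector_mult_le)
      also have "\<dots> \<le> L * norm v"
        using L[OF \<open>t \<in> T\<close> that] by (intro mult_right_mono) auto
      finally show "norm (A t x *v v) \<le> L * norm v" .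
    qed
  qed (use that in auto)
  with \<open>L > 0\<close> show thesis
    by (intro that[of L]) auto
qed

lemma lipschitz_of_continuous_derivative:
  fixes g :: "real^'m::finite \<Rightarrow> real^'k::finite" and A :: "real^'m \<Rightarrow> real^'m^'k"
  assumes K: "compact K" "convex K" and A: "continuous_on K A"
    and der: "\<And>x. x \<in> K \<Longrightarrow> (g has_derivative (\<lambda>v. A x *v v)) (at x)"
  obtains L where "L \<ge> 0" "\<And>x y. x \<in> K \<Longrightarrow> y \<in> K \<Longrightarrow> norm (g x - g y) \<le> L * norm (x - y)"
proof -
  have "continuous_on ({0::real} \<times> K) (\<lambda>p. A (snd p))"
    using A by (intro continuous_on_compose2[OF A] continuous_on_snd continuous_on_id) auto
  then have "continuous_on ({0::real} \<times> K) (\<lambda>(t, x). A x)"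
    by (simp add: case_prod_beta')
  from uniformly_lipschitz_family[OF _ K this, of "\<lambda>_. g"] der that
  show thesis by (metis compact_sing singletonI)
qed

text \<open>Moving along the fixed direction \<open>G p\<close>, the slope of \<rho> stays bounded
  below near \<open>p\<close>, so a distance proportional to \<open>\<bar>\<rho> x\<bar>\<close>
  suffices to reach a zero. A Lipschitz function that vanishes on the zero set is therefore bounded
  by a multiple of \<open>\<bar>\<rho> x\<bar>\<close>.\<close>

lemma exists_nearby_zero:
  fixes \<rho> :: "'a::real_inner \<Rightarrow> real"
  assumes r: "r > 0" and der: "\<And>x. x \<in> cball p r \<Longrightarrow> (\<rho> has_derivative (\<lambda>v. G x \<bullet> v)) (at x)"
    and G: "continuous_on (cball p r) G" and p: "\<rho> p = 0" "G p \<noteq> 0"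
  obtains r' C where "r' > 0" "C \<ge> 0"
    "\<And>x. x \<in> ball p r' \<Longrightarrow> x \<in> cball p r \<and> (\<exists>y\<in>cball p r. \<rho> y = 0 \<and> norm (x - y) \<le> C * \<bar>\<rho> x\<bar>)"
proof -
  define \<nu> where "\<nu> = G p"
  define c where "c = \<nu> \<bullet> \<nu>"
  have \<nu>: "norm \<nu> > 0" and c: "c > 0"
    using p by (auto simp: \<nu>_def c_def)
  have "continuous_on (cball p r) (\<lambda>x. G x \<bullet> \<nu>)"
    using G by (intro continuous_intros)
  then obtain d where d: "d > 0" "\<And>x. x \<in> cball p r \<Longrightarrow> dist x p < d \<Longrightarrow> dist (G x \<bullet> \<nu>) (G p \<bullet> \<nu>) < c / 2"
    using r c unfolding continuous_on_iff by (metis centre_in_cball half_gt_zero less_imp_le)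
  define r0 where "r0 = min r (d / 2)"
  have r0: "r0 > 0" "r0 \<le> r" using r d by (auto simp: r0_def)
  have slope: "G x \<bullet> \<nu> \<ge> c / 2" if "x \<in> cball p r0" for x
  proof -
    have "dist (G x \<bullet> \<nu>) c < c / 2"
      using d(2)[of x] that r0 d(1) by (auto simp: r0_def c_def \<nu>_def dist_commute)
    then show ?thesis by (auto simp: dist_real_def abs_if split: if_splits)
  qed
  have "isCont \<rho> p"
    using der[of p] r by (auto intro: has_derivative_continuous)
  \<comment> \<open>The threshold is chosen so that the displacement of length
    \<open>\<tau> * norm \<nu>\<close> used below is less than \<open>r0 / 2\<close>; the other half
    of \<open>r0\<close> is left for the distance from \<open>p\<close> to \<open>x\<close>.\<close>
  then obtain d' where d': "d' > 0" "\<And>x. dist x p < d' \<Longrightarrow> dist (\<rho> x) (\<rho> p) < c * r0 / (4 * norm \<nu>)"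
    using r0 c \<nu> unfolding continuous_at_eps_delta by (metis divide_pos_pos mult_pos_pos zero_less_numeral)
  define r' where "r' = min (r0 / 2) d'"
  have "r' > 0" using r0 d' by (simp add: r'_def)
  moreover have "x \<in> cball p r \<and> (\<exists>y\<in>cball p r. \<rho> y = 0 \<and> norm (x - y) \<le> (2 * norm \<nu> / c) * \<bar>\<rho> x\<bar>)"
    if "x \<in> ball p r'" for x
  proof -
    \<comment> \<open>A slope of at least \<open>c / 2\<close> over the parameter length
      \<open>2 * \<bar>\<rho> x\<bar> / c\<close> outweighs the value \<open>\<rho> x\<close>, so
      the sign changes between \<open>-\<tau>\<close> and \<open>\<tau>\<close>.\<close>
    define \<tau> where "\<tau> = 2 * \<bar>\<rho> x\<bar> / c"
    have "\<tau> \<ge> 0" using c by (simp add: \<tau>_def)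
    have "\<bar>\<rho> x\<bar> < c * r0 / (4 * norm \<nu>)"
      using d'(2)[of x] that p by (simp add: r'_def dist_commute)
    then have \<tau>: "\<tau> * norm \<nu> < r0 / 2"
      using c \<nu> by (simp add: \<tau>_def field_simps)
    have near: "x + s *\<^sub>R \<nu> \<in> cball p r0" if "\<bar>s\<bar> \<le> \<tau>" for s
    proof -
      have "norm (s *\<^sub>R \<nu>) \<le> \<tau> * norm \<nu>"
        using that by (simp add: mult_right_mono)
      moreover have "dist p (x + s *\<^sub>R \<nu>) \<le> dist p x + norm (s *\<^sub>R \<nu>)"
        using dist_triangle[of p "x + s *\<^sub>R \<nu>" x] by (simp add: dist_norm)
      moreover have "dist p x < r0 / 2"
        using \<open>x \<in> ball p r'\<close> by (simp add: r'_def)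
      ultimately show ?thesis using \<tau> by simp
    qed
    have der_k: "((\<lambda>s. \<rho> (x + s *\<^sub>R \<nu>)) has_derivative (\<lambda>v. v * (G (x + s *\<^sub>R \<nu>) \<bullet> \<nu>))) (at s within S)"
      if "\<bar>s\<bar> \<le> \<tau>" for s S
    proof -
      have "((\<lambda>s. x + s *\<^sub>R \<nu>) has_derivative (\<lambda>v. v *\<^sub>R \<nu>)) (at s within S)"
        by (auto intro!: derivative_eq_intros)
      from has_derivative_compose[OF this der] near[OF that] r0 show ?thesis by auto
    qed
    have mvt: "\<rho> (x + b *\<^sub>R \<nu>) - \<rho> (x + a *\<^sub>R \<nu>) \<ge> (b - a) * (c / 2)" if "-\<tau> \<le> a" "a \<le> b" "b \<le> \<tau>" for a b
    proof (cases "a = b")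
      case False
      then have "\<exists>\<xi>\<in>{a<..<b}. \<rho> (x + b *\<^sub>R \<nu>) - \<rho> (x + a *\<^sub>R \<nu>) = (b - a) * (G (x + \<xi> *\<^sub>R \<nu>) \<bullet> \<nu>)"
        using that by (intro mvt_simple der_k) auto
      then obtain \<xi> where "\<xi> \<in> {a<..<b}" and eq: "\<rho> (x + b *\<^sub>R \<nu>) - \<rho> (x + a *\<^sub>R \<nu>) = (b - a) * (G (x + \<xi> *\<^sub>R \<nu>) \<bullet> \<nu>)"
        by blast
      then have "G (x + \<xi> *\<^sub>R \<nu>) \<bullet> \<nu> \<ge> c / 2"
        using that by (intro slope near) auto
      then show ?thesis
        unfolding eq using that by (intro mult_left_mono) auto
    qed simp
    have lo: "\<rho> (x + (-\<tau>) *\<^sub>R \<nu>) \<le> 0" and hi: "\<rho> (x + \<tau> *\<^sub>R \<nu>) \<ge> 0"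
      using mvt[of "-\<tau>" 0] mvt[of 0 \<tau>] \<open>\<tau> \<ge> 0\<close> c by (auto simp: \<tau>_def)
    have "\<exists>s\<ge>-\<tau>. s \<le> \<tau> \<and> \<rho> (x + s *\<^sub>R \<nu>) = 0"
      using lo hi \<open>\<tau> \<ge> 0\<close>
      by (intro IVT') (auto intro!: has_derivative_continuous_on[OF der_k])
    then obtain s where s: "\<bar>s\<bar> \<le> \<tau>" "\<rho> (x + s *\<^sub>R \<nu>) = 0"
      by (metis abs_le_iff minus_le_iff)
    have "norm (x - (x + s *\<^sub>R \<nu>)) \<le> \<tau> * norm \<nu>"
      using s by (simp add: mult_right_mono)
    also have "\<dots> = (2 * norm \<nu> / c) * \<bar>\<rho> x\<bar>"
      by (simp add: \<tau>_def)
    finally have "\<exists>y\<in>cball p r. \<rho> y = 0 \<and> norm (x - y) \<le> (2 * norm \<nu> / c) * \<bar>\<rho> x\<bar>"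
      using s near[of s] r0 by (intro bexI[of _ "x + s *\<^sub>R \<nu>"]) auto
    moreover have "x \<in> cball p r"
      using that r0 by (simp add: r'_def)
    ultimately show ?thesis by blast
  qed
  ultimately show thesis
    using \<nu> c by (intro that[of r' "2 * norm \<nu> / c"]) auto
qed

section \<open>Characteristic leaves and the boundary\<close>

text \<open>This keeps those data of \<open>unif_convex_domain\<close> that are not tied to the base
  point, so one pair \<open>U\<close>, \<open>\<rho>\<close> serves at all boundary points inside
  \<open>U\<close>.\<close>

definition local_defining :: "(real^'m::finite) set \<Rightarrow> (real^'m) set \<Rightarrow> (real^'m \<Rightarrow> real) \<Rightarrow> bool" where
  "local_defining \<Omega> U \<rho> \<longleftrightarrow> open U \<and> smooth_on U \<rho> \<and>
     (\<forall>x\<in>U. x \<in> \<Omega> \<longleftrightarrow> \<rho> x < 0) \<and> (\<forall>x\<in>U. grad \<rho> x \<noteq> 0)"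

lemma unif_convex_domain_local_defining:
  assumes "unif_convex_domain \<Omega>" "p \<in> frontier \<Omega>"
  obtains U \<rho> where "local_defining \<Omega> U \<rho>" "p \<in> U"
  using assms unfolding unif_convex_domain_def local_defining_def by metis

text \<open>The defining condition speaks only of the sign of \<rho> on \<Omega>. Positive values
  cannot occur on the frontier because they persist on an open set disjoint from \<Omega>;
  conversely, from a zero of \<rho> a short step against the nonzero gradient enters
  \<Omega>.\<close>

lemma frontier_iff_local_defining:
  assumes \<Omega>: "open \<Omega>" and loc: "local_defining \<Omega> U \<rho>" and x: "x \<in> U"
  shows "x \<in> frontier \<Omega> \<longleftrightarrow> \<rho> x = 0"
proof
  have U: "open U" and sm: "smooth_on U \<rho>" and iff: "\<And>x. x \<in> U \<Longrightarrow> x \<in> \<Omega> \<longleftrightarrow> \<rho> x < 0"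
      and g: "grad \<rho> x \<noteq> 0"
    using loc x by (auto simp: local_defining_def)
  note der = smooth_on_grad_hess(1)[OF U sm]
  have cont: "continuous_on U \<rho>"
    using der by (intro has_derivative_continuous_on) (auto intro: has_derivative_at_withinI)
  {
    assume fr: "x \<in> frontier \<Omega>"
    then have "\<rho> x \<ge> 0"
      using \<Omega> iff[OF x] by (auto simp: frontier_def interior_open)
    moreover have "\<not> \<rho> x > 0"
    proof
      assume "\<rho> x > 0"
      moreover have "open (U \<inter> \<rho> -` {0<..})"
        using cont U by (intro continuous_open_preimage) auto
      moreover have "x \<in> closure \<Omega>"
        using fr by (simp add: frontier_def)
      ultimately have "\<Omega> \<inter> (U \<inter> \<rho> -` {0<..}) \<noteq> {}"
        using x by (metis (no_types, lifting) IntI disjoint_iff greaterThan_iff open_Int_closure_eq_empty vimageI inf_commute)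
      then show False using iff by fastforce
    qed
    ultimately show "\<rho> x = 0" by simp
  }
  assume \<rho>: "\<rho> x = 0"
  define k where "k s = \<rho> (x - s *\<^sub>R grad \<rho> x)" for s
  have "((\<lambda>s. x - s *\<^sub>R grad \<rho> x) has_derivative (\<lambda>v. - (v *\<^sub>R grad \<rho> x))) (at 0)"
    by (auto intro!: derivative_eq_intros)
  from has_derivative_compose[OF this, of \<rho> "\<lambda>v. grad \<rho> x \<bullet> v"] der[OF x]
  have "(k has_derivative (\<lambda>v. - v * (grad \<rho> x \<bullet> grad \<rho> x))) (at 0)"
    by (simp add: k_def[abs_def])
  then have "DERIV k 0 :> - (grad \<rho> x \<bullet> grad \<rho> x)"
    unfolding has_field_derivative_def by (rule has_derivative_eq_rhs) (auto simp: fun_eq_iff)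
  then obtain d where d: "d > 0" "\<And>h. 0 < h \<Longrightarrow> h < d \<Longrightarrow> k (0 + h) < k 0"
    using DERIV_neg_dec_right[of k "- (grad \<rho> x \<bullet> grad \<rho> x)" 0] g
    by (metis inner_gt_zero_iff neg_less_0_iff_less)
  have "x \<in> closure \<Omega>"
    unfolding closure_approachable
  proof (intro allI impI)
    fix e :: real assume "e > 0"
    obtain e' where e': "e' > 0" "ball x e' \<subseteq> U"
      using U x open_contains_ball by blast
    define h where "h = min (d / 2) (min e e' / (2 * norm (grad \<rho> x)))"
    have h: "h > 0" "h < d" using d g \<open>e > 0\<close> e' by (auto simp: h_def)
    have "h * norm (grad \<rho> x) \<le> min e e' / (2 * norm (grad \<rho> x)) * norm (grad \<rho> x)"
      by (intro mult_right_mono) (auto simp: h_def)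
    also have "\<dots> < min e e'"
      using g \<open>e > 0\<close> e' by (simp add: min_def)
    finally have n: "norm (h *\<^sub>R grad \<rho> x) < min e e'"
      using h by simp
    then have "x - h *\<^sub>R grad \<rho> x \<in> U"
      using e' by (intro subsetD[OF e'(2)]) (simp add: dist_norm)
    moreover have "\<rho> (x - h *\<^sub>R grad \<rho> x) < 0"
      using d(2)[OF h] \<rho> by (simp add: k_def)
    ultimately have "x - h *\<^sub>R grad \<rho> x \<in> \<Omega>"
      using iff by blast
    moreover have "dist (x - h *\<^sub>R grad \<rho> x) x < e"
      using n by (simp add: dist_norm)
    ultimately show "\<exists>y\<in>\<Omega>. dist y x < e" by blast
  qed
  moreover have "x \<notin> \<Omega>" using iff[OF x] \<rho> by simp
  ultimately show "x \<in> frontier \<Omega>"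
    using \<Omega> by (simp add: frontier_def interior_open)
qed

lemma tangent_space_grad_orthogonal:
  assumes \<Omega>: "open \<Omega>" and loc: "local_defining \<Omega> U \<rho>" and q: "q \<in> U"
    and w: "w \<in> tangent_space (frontier \<Omega>) q"
  shows "grad \<rho> q \<bullet> w = 0"
proof -
  have U: "open U" and sm: "smooth_on U \<rho>"
    using loc by (auto simp: local_defining_def)
  obtain c e where e: "e > 0" "\<And>s. s \<in> {-e<..<e} \<Longrightarrow> c s \<in> frontier \<Omega>" and c0: "c 0 = q"
      and derc: "(c has_vector_derivative w) (at 0)"
    using w unfolding tangent_space_def by blast
  have "((\<lambda>s. \<rho> (c s)) has_derivative (\<lambda>v. grad \<rho> q \<bullet> (v *\<^sub>R w))) (at 0)"
    using has_derivative_compose[OF derc[unfolded has_vector_derivative_def], of \<rho>]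
      smooth_on_grad_hess(1)[OF U sm q] c0 by blast
  moreover have "((\<lambda>s. \<rho> (c s)) has_derivative (\<lambda>v. 0)) (at 0)"
  proof -
    have "isCont c 0"
      using derc by (rule has_vector_derivative_continuous)
    then have "\<forall>\<^sub>F s in at 0. c s \<in> U"
      using U q c0 by (auto simp: isCont_def intro: topological_tendstoD)
    moreover have "\<forall>\<^sub>F s in at 0. s \<in> {-e<..<e}"
      using e by (intro eventually_at_in_open') auto
    ultimately have "\<forall>\<^sub>F s in at 0. \<rho> (c s) = 0"
      by eventually_elim (use e frontier_iff_local_defining[OF \<Omega> loc] in blast)
    moreover have "\<rho> (c 0) = 0"
      using e frontier_iff_local_defining[OF \<Omega> loc q] c0 by auto
    ultimately show ?thesis
      by (intro has_derivative_transform_eventually[OF has_derivative_const]) (auto elim: eventually_mono)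
  qed
  ultimately have "(\<lambda>v. grad \<rho> q \<bullet> (v *\<^sub>R w)) = (\<lambda>v. 0)"
    by (rule has_derivative_unique)
  from fun_cong[OF this, of 1] show ?thesis by simp
qed

text \<open>The integral curve of \<open>J0 (grad \<rho>)\<close> through \<open>p\<close> keeps
  \<rho> constant, since \<open>u \<bullet> J0 u = 0\<close>; hence it stays in the frontier and its
  velocity is characteristic. So \<open>f\<close> is constant along it, and differentiating at time
  0 gives the claim: the Hamiltonian field \<open>J0 g\<close> is tangent to the boundary.\<close>

lemma char_leaf_gradient_orthogonal:
  fixes \<Omega> :: "(real^('n::finite + 'n)) set"
  assumes \<Omega>: "open \<Omega>" and loc: "local_defining \<Omega> U \<rho>" and p: "p \<in> U" "p \<in> frontier \<Omega>"
    and h: "const_on_char_leaves \<Omega> f" and f: "(f has_derivative (\<lambda>v. g \<bullet> v)) (at p)"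
  shows "grad \<rho> p \<bullet> J0 g = 0"
proof -
  have U: "open U" and sm: "smooth_on U \<rho>"
    using loc by (auto simp: local_defining_def)
  note G = smooth_on_grad_hess[OF U sm]
  obtain r where r: "r > 0" "cball p r \<subseteq> U"
    using U p open_contains_cball by blast
  obtain L where L: "\<And>x y. x \<in> cball p r \<Longrightarrow> y \<in> cball p r \<Longrightarrow> norm (grad \<rho> x - grad \<rho> y) \<le> L * norm (x - y)"
    using lipschitz_of_continuous_derivative[of "cball p r" "hess \<rho>" "grad \<rho>"] G r
    by (metis (no_types, lifting) compact_cball continuous_on_subset convex_cball subsetD)
  have "norm (J0 (grad \<rho> x) - J0 (grad \<rho> y)) \<le> L * norm (x - y)" if "x \<in> cball p r" "y \<in> cball p r" for x y
    using L[OF that] by (metis linear_J0 linear_diff norm_J0)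
  from picard_local_solution[OF r(1) this]
  obtain \<gamma> \<delta> where \<delta>: "\<delta> > 0" "\<gamma> 0 = p" "\<And>s. s \<in> {-\<delta>..\<delta>} \<Longrightarrow> \<gamma> s \<in> cball p r"
    and der\<gamma>: "\<And>s. s \<in> {-\<delta>..\<delta>} \<Longrightarrow> (\<gamma> has_vector_derivative J0 (grad \<rho> (\<gamma> s))) (at s within {-\<delta>..\<delta>})"
    by blast
  have \<gamma>U: "\<gamma> s \<in> U" if "s \<in> {-\<delta>..\<delta>}" for s
    using \<delta>(3)[OF that] r by blast
  have zero: "\<rho> (\<gamma> s) = 0" if s: "s \<in> {-\<delta>..\<delta>}" for s
  proof -
    have "((\<lambda>s. \<rho> (\<gamma> s)) has_derivative (\<lambda>v. 0)) (at s within {-\<delta>..\<delta>})" if "s \<in> {-\<delta>..\<delta>}" for s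
      using has_derivative_compose[OF der\<gamma>[OF that, unfolded has_vector_derivative_def] G(1)[OF \<gamma>U[OF that]]]
      by (simp add: J0_inner_self)
    then have "\<rho> (\<gamma> s) = \<rho> (\<gamma> 0)"
      using has_derivative_zero_unique[of "{-\<delta>..\<delta>}" "\<lambda>s. \<rho> (\<gamma> s)" s 0] s \<delta> by auto
    then show ?thesis
      using frontier_iff_local_defining[OF \<Omega> loc p(1)] p \<delta> by simp
  qed
  then have fr: "\<gamma> s \<in> frontier \<Omega>" if "s \<in> {-\<delta>..\<delta>}" for s
    using frontier_iff_local_defining[OF \<Omega> loc \<gamma>U[OF that]] that by blast
  \<comment> \<open>\<open>tangent_space\<close> asks for a curve in the frontier on both sides of
    its base point; restricting \<open>s\<close> to half the range leaves room for
    \<open>s + \<sigma>\<close>.\<close>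
  have tangent: "J0 (grad \<rho> (\<gamma> s)) \<in> tangent_space (frontier \<Omega>) (\<gamma> s)" if s: "s \<in> {0..\<delta>/2}" for s
    unfolding tangent_space_def
  proof (intro CollectI exI conjI)
    have "(\<gamma> has_vector_derivative J0 (grad \<rho> (\<gamma> s))) (at s)"
      using der\<gamma>[of s] s \<delta> at_within_interior[of s "{-\<delta>..\<delta>}"] by auto
    then have "(\<gamma> has_vector_derivative J0 (grad \<rho> (\<gamma> s))) (at (s + 0))"
      by simp
    moreover have "((\<lambda>\<sigma>. s + \<sigma>) has_vector_derivative 1) (at 0)"
      by (auto intro!: derivative_eq_intros)
    ultimately show "((\<lambda>\<sigma>. \<gamma> (s + \<sigma>)) has_vector_derivative J0 (grad \<rho> (\<gamma> s))) (at 0)"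
      using vector_diff_chain_at[of "\<lambda>\<sigma>. s + \<sigma>" 1 0 \<gamma>] by (simp add: o_def)
    show "\<delta> / 2 > 0" using \<delta> by simp
    show "\<forall>\<sigma>\<in>{- (\<delta> / 2)<..<\<delta> / 2}. \<gamma> (s + \<sigma>) \<in> frontier \<Omega>"
      using s by (auto intro!: fr)
  qed simp
  have kernel: "J0 (grad \<rho> (\<gamma> s)) \<in> char_kernel (frontier \<Omega>) (\<gamma> s)" if s: "s \<in> {0..\<delta>/2}" for s
  proof -
    have "omega0 (J0 (grad \<rho> (\<gamma> s))) w = 0" if "w \<in> tangent_space (frontier \<Omega>) (\<gamma> s)" for w
      using tangent_space_grad_orthogonal[OF \<Omega> loc _ that] \<gamma>U[of s] s by (simp add: omega0_J0)
    with tangent[OF s] show ?thesis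
      unfolding char_kernel_def by blast
  qed
  have const: "f (\<gamma> b) = f p" if b: "b \<in> {0..\<delta>/2}" for b
  proof -
    have "\<gamma> s \<in> frontier \<Omega> \<and> (\<exists>v. (\<gamma> has_vector_derivative v) (at s within {0..b}) \<and> v \<in> char_kernel (frontier \<Omega>) (\<gamma> s))"
      if "s \<in> {0..b}" for s
    proof (intro conjI exI)
      show "(\<gamma> has_vector_derivative J0 (grad \<rho> (\<gamma> s))) (at s within {0..b})"
        using b that by (intro has_vector_derivative_within_subset[OF der\<gamma>]) auto
    qed (use b that in \<open>auto intro!: fr kernel\<close>)
    then have "f (\<gamma> 0) = f (\<gamma> b)"
      using h b unfolding const_on_char_leaves_def by (metis atLeastAtMost_iff)
    with \<delta> show ?thesis by simp
  qed
  have "(\<gamma> has_derivative (\<lambda>v. v *\<^sub>R J0 (grad \<rho> p))) (at 0 within {0..\<delta>/2})"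
    using has_vector_derivative_within_subset[OF der\<gamma>[of 0], of "{0..\<delta>/2}"] \<delta>
    by (auto simp: has_vector_derivative_def)
  from has_derivative_compose[OF this, of f "\<lambda>v. g \<bullet> v"] f \<delta>
  have "((\<lambda>s. f (\<gamma> s)) has_vector_derivative g \<bullet> J0 (grad \<rho> p)) (at 0 within {0..\<delta>/2})"
    by (simp add: has_vector_derivative_def)
  moreover have "((\<lambda>s. f (\<gamma> s)) has_vector_derivative 0) (at 0 within {0..\<delta>/2})"
    by (rule has_vector_derivative_transform[where f="\<lambda>_. f p"]) (use const \<delta> in auto)
  moreover have "at 0 within {0..\<delta>/2} \<noteq> bot"
    using \<delta> by (simp add: at_within_Icc_at_right)
  ultimately have "g \<bullet> J0 (grad \<rho> p) = 0"
    using vector_derivative_unique_within by blast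
  then show ?thesis
    using J0_inner[of "grad \<rho> p" g] by (simp add: inner_commute)
qed

section \<open>The flow of a positive path\<close>

lemma unif_convex_domainD:
  assumes "unif_convex_domain \<Omega>"
  shows "open \<Omega>" "bounded \<Omega>" "convex \<Omega>" "compact (closure \<Omega>)" "convex (closure \<Omega>)"
  using assms by (auto simp: unif_convex_domain_def compact_closure convex_closure)

lemma closure_open_eq_Un_frontier: "open S \<Longrightarrow> closure S = S \<union> frontier S"
  by (simp add: closure_Un_frontier[symmetric] Un_commute)

locale hamiltonian_path =
  fixes \<Omega> :: "(real^('n::finite + 'n)) set"
    and \<phi> :: "real \<Rightarrow> real^('n + 'n) \<Rightarrow> real^('n + 'n)"
    and H :: "real \<Rightarrow> real^('n + 'n) \<Rightarrow> real"
  assumes dom: "unif_convex_domain \<Omega>" and path: "positive_path \<Omega> \<phi> H"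
begin

lemma der_grad_hess:
  assumes "t \<in> {0..1}" "z \<in> closure \<Omega>"
  shows "(H t has_derivative (\<lambda>v. grad (H t) z \<bullet> v)) (at z)"
    and "(grad (H t) has_derivative (\<lambda>v. hess (H t) z *v v)) (at z)"
proof -
  obtain W where W: "open W" "{0..1} \<times> closure \<Omega> \<subseteq> W" "smooth_on W (\<lambda>(t, z). H t z)"
    using path unfolding positive_path_def by blast
  with assms have "(t, z) \<in> W" by blast
  with smooth_on_family_grad_hess[OF W(1,3)]
  show "(H t has_derivative (\<lambda>v. grad (H t) z \<bullet> v)) (at z)"
    "(grad (H t) has_derivative (\<lambda>v. hess (H t) z *v v)) (at z)" by auto
qed

lemma continuous_grad_hess:
  shows "continuous_on ({0..1} \<times> closure \<Omega>) (\<lambda>(t, z). grad (H t) z)"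
    and "continuous_on ({0..1} \<times> closure \<Omega>) (\<lambda>(t, z). hess (H t) z)"
proof -
  obtain W where W: "open W" "{0..1} \<times> closure \<Omega> \<subseteq> W" "smooth_on W (\<lambda>(t, z). H t z)"
    using path unfolding positive_path_def by blast
  with smooth_on_family_grad_hess[OF W(1,3)]
  show "continuous_on ({0..1} \<times> closure \<Omega>) (\<lambda>(t, z). grad (H t) z)"
    "continuous_on ({0..1} \<times> closure \<Omega>) (\<lambda>(t, z). hess (H t) z)"
    by (auto intro: continuous_on_subset)
qed

lemma flow_derivative:
  assumes "t \<in> {0..1}" "z \<in> closure \<Omega>"
  shows "((\<lambda>s. \<phi> s z) has_vector_derivative J0 (grad (H t) (\<phi> t z))) (at t within {0..1})"
  using path assms unfolding positive_path_def by blast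

lemma flow_initial: "z \<in> closure \<Omega> \<Longrightarrow> \<phi> 0 z = z"
  using path unfolding positive_path_def by blast

lemma continuous_on_flow_time: "z \<in> closure \<Omega> \<Longrightarrow> continuous_on {0..1} (\<lambda>t. \<phi> t z)"
  using flow_derivative
  by (intro has_derivative_continuous_on) (auto simp: has_vector_derivative_def)

text \<open>The normal component vanishes on the zero set of \<rho> by
  \<open>char_leaf_gradient_orthogonal\<close> and is Lipschitz in space uniformly in time;
  comparing \<open>x\<close> with a zero of \<rho> supplied by \<open>exists_nearby_zero\<close>
  gives the bound. The ball contains points outside the closure too, since trajectories are not yet
  known to stay inside.\<close>

lemma normal_velocity_bound:
  assumes loc: "local_defining \<Omega> U \<rho>" and p: "p \<in> U" "p \<in> frontier \<Omega>" and t0: "t0 \<in> {0..1}"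
  obtains r' \<delta> C where "r' > 0" "\<delta> > 0" "C \<ge> 0" "ball p r' \<subseteq> U"
    "\<And>t x. t \<in> {0..1} \<Longrightarrow> \<bar>t - t0\<bar> \<le> \<delta> \<Longrightarrow> x \<in> ball p r' \<Longrightarrow> \<bar>grad \<rho> x \<bullet> J0 (grad (H t) x)\<bar> \<le> C * \<bar>\<rho> x\<bar>"
proof -
  have \<Omega>: "open \<Omega>" using dom by (rule unif_convex_domainD)
  have U: "open U" and sm: "smooth_on U \<rho>" and gp: "grad \<rho> p \<noteq> 0"
    using loc p by (auto simp: local_defining_def)
  note G = smooth_on_grad_hess[OF U sm]
  obtain W where W: "open W" "{0..1} \<times> closure \<Omega> \<subseteq> W" "smooth_on W (\<lambda>(t, z). H t z)"
    using path unfolding positive_path_def by blast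
  note HW = smooth_on_family_grad_hess[OF W(1,3)]
  have "(t0, p) \<in> W" using W(2) t0 p by (auto simp: frontier_def)
  from open_prod_elim[OF W(1) this] obtain A B
    where "open A" "open B" "(t0, p) \<in> A \<times> B" "A \<times> B \<subseteq> W" .
  then have AB: "open A" "open B" "t0 \<in> A" "p \<in> B" "A \<times> B \<subseteq> W" by auto
  obtain \<delta> where \<delta>: "\<delta> > 0" "cball t0 \<delta> \<subseteq> A"
    using AB open_contains_cball by blast
  have "open (U \<inter> B)" "p \<in> U \<inter> B" using U AB p by auto
  then obtain r where r: "r > 0" "cball p r \<subseteq> U \<inter> B"
    using open_contains_cball by blast
  define T where "T = {0..1} \<inter> cball t0 \<delta>"
  have T: "compact T" by (simp add: T_def compact_Int)
  have TW: "T \<times> cball p r \<subseteq> W"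
    using \<delta> r AB by (auto simp: T_def)
  obtain L1 where L1: "L1 \<ge> 0" "\<And>x y. x \<in> cball p r \<Longrightarrow> y \<in> cball p r \<Longrightarrow> norm (grad \<rho> x - grad \<rho> y) \<le> L1 * norm (x - y)"
  proof (rule lipschitz_of_continuous_derivative[of "cball p r" "hess \<rho>" "grad \<rho>"])
    show "continuous_on (cball p r) (hess \<rho>)" using G(4) r by (auto intro: continuous_on_subset)
  qed (use G(2) r in auto)
  obtain L2 where L2: "L2 \<ge> 0" "\<And>t x y. t \<in> T \<Longrightarrow> x \<in> cball p r \<Longrightarrow> y \<in> cball p r \<Longrightarrow>
      norm (grad (H t) x - grad (H t) y) \<le> L2 * norm (x - y)"
  proof (rule uniformly_lipschitz_family[OF T, of "cball p r" "\<lambda>t. hess (H t)" "\<lambda>t. grad (H t)"])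
    show "continuous_on (T \<times> cball p r) (\<lambda>(t, x). hess (H t) x)"
      using HW(4) TW by (rule continuous_on_subset)
    show "(grad (H t) has_derivative (\<lambda>v. hess (H t) x *v v)) (at x)" if "t \<in> T" "x \<in> cball p r" for t x
      using HW(2) TW that by blast
  qed auto
  have "bounded ((\<lambda>(t, x). grad (H t) x) ` (T \<times> cball p r))"
    using T continuous_on_subset[OF HW(3) TW] by (intro compact_imp_bounded compact_continuous_image compact_Times) auto
  then obtain M1 where M1: "M1 > 0" "\<And>t x. t \<in> T \<Longrightarrow> x \<in> cball p r \<Longrightarrow> norm (grad (H t) x) \<le> M1"
    unfolding bounded_pos by (fastforce simp: image_iff)
  have "bounded (grad \<rho> ` cball p r)"
    using G(3) r by (intro compact_imp_bounded compact_continuous_image) (auto intro: continuous_on_subset)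
  then obtain M2 where M2: "M2 > 0" "\<And>x. x \<in> cball p r \<Longrightarrow> norm (grad \<rho> x) \<le> M2"
    unfolding bounded_pos by auto
  define K where "K = L1 * M1 + M2 * L2"
  have K: "K \<ge> 0" using L1 L2 M1 M2 by (simp add: K_def)
  have lip: "\<bar>grad \<rho> x \<bullet> J0 (grad (H t) x) - grad \<rho> y \<bullet> J0 (grad (H t) y)\<bar> \<le> K * norm (x - y)"
    if "t \<in> T" "x \<in> cball p r" "y \<in> cball p r" for t x y
  proof -
    have "grad \<rho> x \<bullet> J0 (grad (H t) x) - grad \<rho> y \<bullet> J0 (grad (H t) y)
        = (grad \<rho> x - grad \<rho> y) \<bullet> J0 (grad (H t) x) + grad \<rho> y \<bullet> J0 (grad (H t) x - grad (H t) y)"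
      by (simp add: linear_diff[OF linear_J0] algebra_simps)
    moreover have "\<bar>(grad \<rho> x - grad \<rho> y) \<bullet> J0 (grad (H t) x)\<bar> \<le> (L1 * norm (x - y)) * M1"
      using L1 M1 that by (intro order_trans[OF Cauchy_Schwarz_ineq2] mult_mono) auto
    moreover have "\<bar>grad \<rho> y \<bullet> J0 (grad (H t) x - grad (H t) y)\<bar> \<le> M2 * (L2 * norm (x - y))"
      using L2 M2 that by (intro order_trans[OF Cauchy_Schwarz_ineq2] mult_mono) (auto simp: less_imp_le)
    ultimately show ?thesis
      by (simp add: K_def algebra_simps)
  qed
  have vanish: "grad \<rho> y \<bullet> J0 (grad (H t) y) = 0" if "t \<in> T" "y \<in> cball p r" "\<rho> y = 0" for t y
  proof (rule char_leaf_gradient_orthogonal[OF \<Omega> loc, of y "H t"])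
    show "y \<in> U" using that r by blast
    then show fr: "y \<in> frontier \<Omega>"
      using frontier_iff_local_defining[OF \<Omega> loc] that by blast
    show "const_on_char_leaves \<Omega> (H t)"
      using path that unfolding positive_path_def T_def by blast
    show "(H t has_derivative (\<lambda>v. grad (H t) y \<bullet> v)) (at y)"
      using HW(1) TW that by blast
  qed
  have "\<rho> p = 0" using frontier_iff_local_defining[OF \<Omega> loc p(1)] p by blast
  moreover have "continuous_on (cball p r) (grad \<rho>)"
    using G(3) r by (auto intro: continuous_on_subset)
  moreover have "(\<rho> has_derivative (\<lambda>v. grad \<rho> x \<bullet> v)) (at x)" if "x \<in> cball p r" for x
    using G(1) r that by blast
  ultimately obtain r' C where r': "r' > 0" "C \<ge> 0"
    "\<And>x. x \<in> ball p r' \<Longrightarrow> x \<in> cball p r \<and> (\<exists>y\<in>cball p r. \<rho> y = 0 \<and> norm (x - y) \<le> C * \<bar>\<rho> x\<bar>)"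
    using exists_nearby_zero[OF r(1), of p \<rho> "grad \<rho>"] gp by blast
  show thesis
  proof (rule that[OF r'(1) \<delta>(1)])
    show "0 \<le> K * C" using K r' by simp
    show "ball p r' \<subseteq> U" using r'(3) r by blast
    fix t x assume t: "t \<in> {0..1}" "\<bar>t - t0\<bar> \<le> \<delta>" and x: "x \<in> ball p r'"
    have tT: "t \<in> T" using t by (simp add: T_def dist_real_def abs_minus_commute)
    obtain y where y: "y \<in> cball p r" "\<rho> y = 0" "norm (x - y) \<le> C * \<bar>\<rho> x\<bar>" and xr: "x \<in> cball p r"
      using r'(3)[OF x] by blast
    have "\<bar>grad \<rho> x \<bullet> J0 (grad (H t) x)\<bar> \<le> K * norm (x - y)"
      using lip[OF tT xr y(1)] vanish[OF tT y(1,2)] by simp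
    also have "\<dots> \<le> K * (C * \<bar>\<rho> x\<bar>)"
      using y(3) K by (rule mult_left_mono)
    finally show "\<bar>grad \<rho> x \<bullet> J0 (grad (H t) x)\<bar> \<le> K * C * \<bar>\<rho> x\<bar>" by simp
  qed
qed

text \<open>Along the trajectory, \<open>\<rho> (\<phi> t z)\<close> has a derivative bounded by
  \<open>C\<close> times its own absolute value; as it vanishes at \<open>t0\<close>,
  \<open>gronwall_norm\<close> makes it vanish at all nearby times, earlier and later.\<close>

lemma frontier_times_open:
  assumes z: "z \<in> closure \<Omega>" and t0: "t0 \<in> {0..1}" and p: "\<phi> t0 z \<in> frontier \<Omega>"
  shows "\<exists>d>0. \<forall>t\<in>{0..1}. dist t t0 < d \<longrightarrow> \<phi> t z \<in> frontier \<Omega>"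
proof -
  have \<Omega>: "open \<Omega>" using dom by (rule unif_convex_domainD)
  obtain U \<rho> where loc: "local_defining \<Omega> U \<rho>" and pU: "\<phi> t0 z \<in> U"
    using unif_convex_domain_local_defining[OF dom p] .
  have U: "open U" and sm: "smooth_on U \<rho>" using loc by (auto simp: local_defining_def)
  obtain r' \<delta> C where r': "r' > 0" "\<delta> > 0" "C \<ge> 0" and bU: "ball (\<phi> t0 z) r' \<subseteq> U"
    and bound: "\<And>t x. t \<in> {0..1} \<Longrightarrow> \<bar>t - t0\<bar> \<le> \<delta> \<Longrightarrow> x \<in> ball (\<phi> t0 z) r' \<Longrightarrow>
        \<bar>grad \<rho> x \<bullet> J0 (grad (H t) x)\<bar> \<le> C * \<bar>\<rho> x\<bar>"
    using normal_velocity_bound[OF loc pU p t0] by blast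
  obtain d where d: "d > 0" "\<And>t. t \<in> {0..1} \<Longrightarrow> dist t t0 < d \<Longrightarrow> dist (\<phi> t z) (\<phi> t0 z) < r'"
    using continuous_on_flow_time[OF z] r'(1) t0 unfolding continuous_on_iff by metis
  define \<eta> where "\<eta> = min (d / 2) \<delta>"
  have \<eta>: "\<eta> > 0" "\<eta> < d" "\<eta> \<le> \<delta>" using d r' by (auto simp: \<eta>_def)
  define a b where "a = max 0 (t0 - \<eta>)" and "b = min 1 (t0 + \<eta>)"
  have ab: "t \<in> {0..1} \<and> \<bar>t - t0\<bar> \<le> \<eta>" if "t \<in> {a..b}" for t
    using that by (auto simp: a_def b_def)
  have ball: "\<phi> t z \<in> ball (\<phi> t0 z) r'" if "t \<in> {a..b}" for t
    using d(2)[of t] ab[OF that] \<eta> by (simp add: dist_real_def dist_commute)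
  have zero: "\<rho> (\<phi> t z) = 0" if t: "t \<in> {a..b}" for t
  proof -
    have "norm (\<rho> (\<phi> t z)) \<le> exp (C * \<bar>t - t0\<bar>) * norm (\<rho> (\<phi> t0 z))"
    proof (rule gronwall_norm[OF _ _ _ t])
      fix s assume s: "s \<in> {a..b}"
      have "((\<lambda>s. \<phi> s z) has_derivative (\<lambda>v. v *\<^sub>R J0 (grad (H s) (\<phi> s z)))) (at s within {a..b})"
        using has_vector_derivative_within_subset[OF flow_derivative[OF _ z], of s "{a..b}"] ab s
        by (auto simp: has_vector_derivative_def)
      moreover have "(\<rho> has_derivative (\<lambda>v. grad \<rho> (\<phi> s z) \<bullet> v)) (at (\<phi> s z))"
        using smooth_on_grad_hess(1)[OF U sm] ball[OF s] bU by blast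
      ultimately show "((\<lambda>s. \<rho> (\<phi> s z)) has_vector_derivative grad \<rho> (\<phi> s z) \<bullet> J0 (grad (H s) (\<phi> s z))) (at s within {a..b})"
        using has_derivative_compose by (fastforce simp: has_vector_derivative_def)
      show "norm (grad \<rho> (\<phi> s z) \<bullet> J0 (grad (H s) (\<phi> s z))) \<le> C * norm (\<rho> (\<phi> s z))"
        using bound[OF _ _ ball[OF s]] ab[OF s] \<eta> by simp
    qed (use t0 \<eta> in \<open>auto simp: a_def b_def\<close>)
    moreover have "\<rho> (\<phi> t0 z) = 0"
      using frontier_iff_local_defining[OF \<Omega> loc pU] p by blast
    ultimately show ?thesis by simp
  qed
  have "\<phi> t z \<in> frontier \<Omega>" if "t \<in> {0..1}" "dist t t0 < \<eta>" for t
  proof -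
    have t: "t \<in> {a..b}" using that by (auto simp: a_def b_def dist_real_def)
    then show ?thesis
      using frontier_iff_local_defining[OF \<Omega> loc] zero ball bU by blast
  qed
  with \<eta> show ?thesis by blast
qed

lemma frontier_times_all_or_none:
  assumes z: "z \<in> closure \<Omega>" and t: "t \<in> {0..1}" "\<phi> t z \<in> frontier \<Omega>" and s: "s \<in> {0..1}"
  shows "\<phi> s z \<in> frontier \<Omega>"
proof -
  let ?S = "{t \<in> {0..1}. \<phi> t z \<in> frontier \<Omega>}"
  have "closedin (top_of_set {0..1}) ({0..1} \<inter> (\<lambda>t. \<phi> t z) -` frontier \<Omega>)"
    by (intro continuous_closedin_preimage continuous_on_flow_time z) auto
  then have "closedin (top_of_set {0..1}) ?S"
    by (simp add: vimage_def Int_def)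
  moreover have "openin (top_of_set {0..1}) ?S"
    unfolding openin_euclidean_subtopology_iff using frontier_times_open[OF z] by fastforce
  moreover have "connected {0..1::real}" by simp
  ultimately have "?S = {} \<or> ?S = {0..1}"
    unfolding connected_clopen by blast
  with t s show ?thesis by blast
qed

lemma flow_frontier: "z \<in> frontier \<Omega> \<Longrightarrow> t \<in> {0..1} \<Longrightarrow> \<phi> t z \<in> frontier \<Omega>"
  using frontier_times_all_or_none[of z 0 t] flow_initial[of z] by (auto simp: frontier_def)

text \<open>A connected orbit leaving \<Omega> would meet the frontier at some time, hence, by
  \<open>frontier_times_all_or_none\<close>, already at time 0.\<close>

lemma flow_interior:
  assumes z: "z \<in> \<Omega>" and t: "t \<in> {0..1}"
  shows "\<phi> t z \<in> \<Omega>"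
proof (rule ccontr)
  assume "\<phi> t z \<notin> \<Omega>"
  have zc: "z \<in> closure \<Omega>" using z closure_subset by blast
  let ?C = "(\<lambda>t. \<phi> t z) ` {0..1}"
  have "connected ?C"
    by (intro connected_continuous_image continuous_on_flow_time zc) auto
  moreover have "z \<in> ?C \<inter> \<Omega>"
    using z flow_initial[OF zc] by (auto intro!: image_eqI[of _ _ 0])
  moreover have "\<phi> t z \<in> ?C - \<Omega>" using t \<open>\<phi> t z \<notin> \<Omega>\<close> by blast
  ultimately have "?C \<inter> frontier \<Omega> \<noteq> {}"
    using connected_Int_frontier[of ?C \<Omega>] by blast
  then have "\<phi> 0 z \<in> frontier \<Omega>"
    using frontier_times_all_or_none[OF zc] by auto
  then show False
    using z flow_initial[OF zc] unif_convex_domainD(1)[OF dom] by (simp add: frontier_def interior_open)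
qed

lemma flow_closure:
  assumes "z \<in> closure \<Omega>" "t \<in> {0..1}"
  shows "\<phi> t z \<in> closure \<Omega>"
  using assms flow_frontier flow_interior closure_open_eq_Un_frontier[OF unif_convex_domainD(1)[OF dom]]
  by blast

text \<open>The definition of the path gives continuity in time only. Now that trajectories stay in
  the closure, a Lipschitz constant \<open>L\<close> of the gradients there bounds the dependence on
  the initial point by the factor \<open>exp L\<close>, uniformly in time. Joint continuity makes
  the flow a homotopy.\<close>

lemma continuous_on_flow: "continuous_on ({0..1} \<times> closure \<Omega>) (\<lambda>(t, z). \<phi> t z)"
proof -
  note \<Omega> = unif_convex_domainD[OF dom]
  obtain L where L: "L \<ge> 0" "\<And>t x y. t \<in> {0..1} \<Longrightarrow> x \<in> closure \<Omega> \<Longrightarrow> y \<in> closure \<Omega> \<Longrightarrow>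
      norm (grad (H t) x - grad (H t) y) \<le> L * norm (x - y)"
    using uniformly_lipschitz_family[of "{0..1::real}" "closure \<Omega>" "\<lambda>t. hess (H t)" "\<lambda>t. grad (H t)"]
      \<Omega> continuous_grad_hess(2) der_grad_hess(2) by (metis (no_types, lifting) compact_Icc)
  have lip: "norm (\<phi> t z - \<phi> t w) \<le> exp L * norm (z - w)"
    if t: "t \<in> {0..1}" and z: "z \<in> closure \<Omega>" and w: "w \<in> closure \<Omega>" for t z w
  proof -
    have "norm (\<phi> t z - \<phi> t w) \<le> exp (L * \<bar>t - 0\<bar>) * norm (\<phi> 0 z - \<phi> 0 w)"
    proof (rule gronwall_norm[OF _ _ _ t])
      fix s assume s: "s \<in> {0..1::real}"
      show "((\<lambda>s. \<phi> s z - \<phi> s w) has_vector_derivative J0 (grad (H s) (\<phi> s z)) - J0 (grad (H s) (\<phi> s w))) (at s within {0..1})"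
        by (intro has_vector_derivative_diff flow_derivative s z w)
      show "norm (J0 (grad (H s) (\<phi> s z)) - J0 (grad (H s) (\<phi> s w))) \<le> L * norm (\<phi> s z - \<phi> s w)"
        using L(2)[OF s flow_closure[OF z s] flow_closure[OF w s]]
        by (simp add: linear_diff[OF linear_J0, symmetric])
    qed simp
    also have "\<dots> \<le> exp L * norm (\<phi> 0 z - \<phi> 0 w)"
      using t L(1) by (intro mult_right_mono) (auto simp: mult_left_le)
    finally show ?thesis
      using flow_initial z w by simp
  qed
  show ?thesis
    unfolding continuous_on_iff
  proof (intro ballI allI impI)
    fix q :: "real \<times> (real^('n + 'n))" and e :: real assume q: "q \<in> {0..1} \<times> closure \<Omega>" and e: "e > 0"
    obtain t :: real and z where tz: "q = (t, z)" "t \<in> {0..1}" "z \<in> closure \<Omega>" using q by auto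
    obtain d where d: "d > 0" "\<And>s. s \<in> {0..1} \<Longrightarrow> dist s t < d \<Longrightarrow> dist (\<phi> s z) (\<phi> t z) < e / 2"
      using continuous_on_flow_time[OF tz(3)] e tz(2) unfolding continuous_on_iff by (metis half_gt_zero)
    have "dist (\<phi> s w) (\<phi> t z) < e"
      if s: "s \<in> {0..1}" and w: "w \<in> closure \<Omega>" and dst: "dist (s, w) (t, z) < min d (e / (2 * exp L))" for s :: real and w
    proof -
      have "dist s t < d" "dist w z < e / (2 * exp L)"
        using dst dist_fst_le[of "(s, w)" "(t, z)"] dist_snd_le[of "(s, w)" "(t, z)"] by auto
      then have "exp L * norm (w - z) < e / 2"
        by (simp add: dist_norm field_simps)
      then have "dist (\<phi> s w) (\<phi> s z) < e / 2"
        using lip[OF s w tz(3)] by (simp add: dist_norm)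
      moreover have "dist (\<phi> s z) (\<phi> t z) < e / 2"
        using d(2)[OF s \<open>dist s t < d\<close>] .
      ultimately show ?thesis
        using dist_triangle[of "\<phi> s w" "\<phi> t z" "\<phi> s z"] by simp
    qed
    then show "\<exists>d>0. \<forall>x'\<in>{0..1} \<times> closure \<Omega>. dist x' q < d \<longrightarrow>
        dist (case x' of (t, z) \<Rightarrow> \<phi> t z) (case q of (t, z) \<Rightarrow> \<phi> t z) < e"
      using d(1) e by (intro exI[of _ "min d (e / (2 * exp L))"]) (auto simp: tz(1))
  qed
qed

end

text \<open>If a point \<open>a\<close> of \<open>S\<close> were missed, composing with a retraction of the punctured space onto
  the frontier and extending the homotopy back to the identity would retract the closure onto the
  frontier.\<close>

lemma boundary_preserving_homotopy_surjective:
  fixes S :: "'a::euclidean_space set"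
  assumes S: "open S" "bounded S" "convex S"
    and cont: "continuous_on ({0..1} \<times> closure S) (\<lambda>(t, z). h t z)"
    and front: "\<And>t z. t \<in> {0..1} \<Longrightarrow> z \<in> frontier S \<Longrightarrow> h t z \<in> frontier S"
    and init: "\<And>z. z \<in> closure S \<Longrightarrow> h 0 z = z" and t: "t \<in> {0..1::real}"
  shows "S \<subseteq> h t ` closure S"
proof (rule ccontr)
  assume "\<not> S \<subseteq> h t ` closure S"
  then obtain a where a: "a \<in> S" "a \<notin> h t ` closure S" by blast
  have fsub: "frontier S \<subseteq> closure S" by (simp add: frontier_def)
  have "frontier S retract_of (- {a})"
    using frontier_retract_of_punctured_universe[of S a] S a by (simp add: interior_open)
  then obtain r where r: "continuous_on (- {a}) r" "r ` (- {a}) \<subseteq> frontier S" "\<And>x. x \<in> frontier S \<Longrightarrow> r x = x"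
    unfolding retract_of_def retraction_def by blast
  have ht: "continuous_on (closure S) (h t)"
    using cont t by (rule continuous_on_slice)
  have rh: "continuous_on (closure S) (\<lambda>z. r (h t z))" "(\<lambda>z. r (h t z)) \<in> closure S \<rightarrow> frontier S"
    using a r(2) by (force intro!: continuous_on_compose2[OF r(1) ht] simp: image_subset_iff)+
  \<comment> \<open>The homotopy is \<open>h (t * s)\<close> for \<open>s\<close> from 0 to 1,
    restricted to the frontier; there \<open>r\<close> is the identity, so composing
    \<open>h t\<close> with \<open>r\<close> changes nothing.\<close>
  have hom: "homotopic_with_canon (\<lambda>x. True) (frontier S) (frontier S) (\<lambda>z. r (h t z)) (\<lambda>z. z)"
  proof (rule homotopic_with_symD, rule homotopic_with_eq)
    have "continuous_on ({0..1} \<times> frontier S) (\<lambda>p. (\<lambda>(t, z). h t z) (t * fst p, snd p))"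
      by (rule continuous_on_compose2[OF cont])
        (use t fsub in \<open>auto intro!: continuous_on_Pair continuous_intros mult_le_one\<close>)
    then show "homotopic_with_canon (\<lambda>x. True) (frontier S) (frontier S) (h 0) (h t)"
      unfolding homotopic_with_def
      using t front by (intro exI[of _ "\<lambda>p. h (t * fst p) (snd p)"])
        (auto simp: case_prod_beta' mult_le_one continuous_map_in_subtopology)
  qed (use t front r init fsub in auto)
  \<comment> \<open>Extending the homotopy within the frontier requires the target to be an absolute
    neighbourhood retract, which it is as a retract of an open set.\<close>
  have "ANR (frontier S)"
    using \<open>frontier S retract_of (- {a})\<close> by (metis ANR_retract_of_ANR ANR_openin ENR_imp_ANR open_imp_ENR open_Compl closed_singleton)
  then obtain g where "continuous_on (closure S) g" "g ` closure S \<subseteq> frontier S" "\<And>x. x \<in> frontier S \<Longrightarrow> g x = x"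
    using Borsuk_homotopy_extension_homotopic[OF _ _ rh hom] fsub
    by (metis closed_subset frontier_closed)
  then have "S \<subseteq> frontier S"
    using frontier_subset_retraction[of S "frontier S" g] S closure_subset[of S] by (auto simp: image_subset_iff)
  then show False
    using a S by (auto simp: frontier_def interior_open)
qed

context hamiltonian_path
begin

lemma flow_closure_image:
  assumes t: "t \<in> {0..1}"
  shows "\<phi> t ` closure \<Omega> = closure \<Omega>"
proof
  note \<Omega> = unif_convex_domainD[OF dom]
  show "\<phi> t ` closure \<Omega> \<subseteq> closure \<Omega>"
    using flow_closure t by blast
  have "continuous_on (closure \<Omega>) (\<phi> t)"
    using continuous_on_flow t by (rule continuous_on_slice)
  then have "closed (\<phi> t ` closure \<Omega>)"
    using \<Omega> by (intro compact_imp_closed compact_continuous_image)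
  moreover have "\<Omega> \<subseteq> \<phi> t ` closure \<Omega>"
    by (rule boundary_preserving_homotopy_surjective[OF \<Omega>(1-3) continuous_on_flow flow_frontier flow_initial t])
  ultimately show "closure \<Omega> \<subseteq> \<phi> t ` closure \<Omega>"
    by (rule closure_minimal[rotated])
qed

lemma flow_frontier_image:
  assumes t: "t \<in> {0..1}"
  shows "\<phi> t ` frontier \<Omega> = frontier \<Omega>"
proof
  show "\<phi> t ` frontier \<Omega> \<subseteq> frontier \<Omega>"
    using flow_frontier t by blast
  show "frontier \<Omega> \<subseteq> \<phi> t ` frontier \<Omega>"
  proof
    fix p assume p: "p \<in> frontier \<Omega>"
    have \<Omega>: "open \<Omega>" by (rule unif_convex_domainD[OF dom])
    have "p \<in> closure \<Omega>" "p \<notin> \<Omega>"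
      using p \<Omega> by (auto simp: frontier_def interior_open)
    then obtain z where z: "z \<in> closure \<Omega>" "p = \<phi> t z"
      using flow_closure_image[OF t] by blast
    then have "z \<notin> \<Omega>" using \<open>p \<notin> \<Omega>\<close> flow_interior t by blast
    with z show "p \<in> \<phi> t ` frontier \<Omega>"
      using closure_open_eq_Un_frontier[OF \<Omega>] by blast
  qed
qed

end

section \<open>Gradient images of strictly convex functions\<close>

lemma pos_def_derivative_strict_mono:
  fixes g :: "real^'m::finite \<Rightarrow> real^'m"
  assumes K: "convex K"
    and der: "\<And>z. z \<in> K \<Longrightarrow> (g has_derivative (\<lambda>v. A z *v v)) (at z)"
    and pos: "\<And>z. z \<in> K \<Longrightarrow> pos_def (A z)"
    and xy: "x \<in> K" "y \<in> K" "x \<noteq> y"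
  shows "(g x - g y) \<bullet> (x - y) > 0"
proof -
  have seg: "y + s *\<^sub>R (x - y) \<in> K" if "s \<in> {0..1}" for s
    using convexD_alt[OF K xy(2,1), of s] that by (simp add: algebra_simps)
  have der_k: "((\<lambda>s. g (y + s *\<^sub>R (x - y)) \<bullet> (x - y)) has_derivative
      (\<lambda>v. v * ((A (y + s *\<^sub>R (x - y)) *v (x - y)) \<bullet> (x - y)))) (at s within {0..1})" if "s \<in> {0..1}" for s
  proof -
    have "((\<lambda>s. y + s *\<^sub>R (x - y)) has_derivative (\<lambda>v. v *\<^sub>R (x - y))) (at s within {0..1})"
      by (auto intro!: derivative_eq_intros)
    from has_derivative_inner_left[OF has_derivative_compose[OF this der[OF seg[OF that]]], of "x - y"]
    show ?thesis
      by (simp add: matrix_vector_mult_scaleR)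
  qed
  have "\<exists>s\<in>{0<..<1}. g (y + 1 *\<^sub>R (x - y)) \<bullet> (x - y) - g (y + 0 *\<^sub>R (x - y)) \<bullet> (x - y) =
      (1 - 0) * ((A (y + s *\<^sub>R (x - y)) *v (x - y)) \<bullet> (x - y))"
    by (rule mvt_simple) (use der_k in auto)
  then obtain s where s: "s \<in> {0<..<1}" and
    eq: "(g x - g y) \<bullet> (x - y) = (A (y + s *\<^sub>R (x - y)) *v (x - y)) \<bullet> (x - y)"
    by (auto simp: inner_diff_left)
  have "pos_def (A (y + s *\<^sub>R (x - y)))"
    using s by (intro pos seg) auto
  then show ?thesis
    unfolding eq using xy by (simp add: pos_def_def inner_commute)
qed

text \<open>The gradient image is determined by the boundary values of the gradient alone: \<open>y\<close> is missed iff
  the strictly convex function \<open>f - \<langle>y, \<cdot>\<rangle>\<close> attains its minimum over the closure at a frontier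
  point, and by convexity this is a first-order condition at that point.\<close>

lemma gradient_image_iff_frontier:
  fixes f :: "real^'m::finite \<Rightarrow> real"
  assumes \<Omega>: "open \<Omega>" "bounded \<Omega>" "convex \<Omega>" "\<Omega> \<noteq> {}"
    and f: "\<And>z. z \<in> closure \<Omega> \<Longrightarrow> (f has_derivative (\<lambda>v. g z \<bullet> v)) (at z)"
    and g: "\<And>z. z \<in> closure \<Omega> \<Longrightarrow> (g has_derivative (\<lambda>v. A z *v v)) (at z)"
    and pos: "\<And>z. z \<in> closure \<Omega> \<Longrightarrow> pos_def (A z)"
  shows "y \<in> g ` \<Omega> \<longleftrightarrow> \<not> (\<exists>p\<in>frontier \<Omega>. \<forall>z\<in>closure \<Omega>. (g p - y) \<bullet> (z - p) \<ge> 0)"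
proof
  have cl: "convex (closure \<Omega>)" "compact (closure \<Omega>)"
    using \<Omega> by (simp_all add: convex_closure compact_closure)
  {
    assume "y \<in> g ` \<Omega>"
    then obtain q where q: "q \<in> \<Omega>" "y = g q" by blast
    \<comment> \<open>By strict monotonicity of \<open>g\<close>, the interior point
      \<open>q\<close> itself violates the first-order condition at every frontier point.\<close>
    have "(g p - y) \<bullet> (q - p) < 0" if "p \<in> frontier \<Omega>" for p
    proof -
      have "p \<in> closure \<Omega>" "p \<noteq> q" "q \<in> closure \<Omega>"
        using that q \<Omega> closure_subset by (auto simp: frontier_def interior_open)
      then have "(g p - g q) \<bullet> (p - q) > 0"
        by (intro pos_def_derivative_strict_mono[OF cl(1) g pos])
      then show ?thesis
        using inner_minus_right[of "g p - g q" "p - q"] q by simp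
    qed
    with q closure_subset show "\<not> (\<exists>p\<in>frontier \<Omega>. \<forall>z\<in>closure \<Omega>. (g p - y) \<bullet> (z - p) \<ge> 0)"
      by (meson in_mono not_less)
  }
  assume no: "\<not> (\<exists>p\<in>frontier \<Omega>. \<forall>z\<in>closure \<Omega>. (g p - y) \<bullet> (z - p) \<ge> 0)"
  have "continuous_on (closure \<Omega>) (\<lambda>z. f z - y \<bullet> z)"
    using f by (intro continuous_intros has_derivative_continuous_on) (auto intro: has_derivative_at_withinI)
  then obtain q where q: "q \<in> closure \<Omega>" and min: "\<And>z. z \<in> closure \<Omega> \<Longrightarrow> f q - y \<bullet> q \<le> f z - y \<bullet> z"
    using continuous_attains_inf[of "closure \<Omega>" "\<lambda>z. f z - y \<bullet> z"] cl \<Omega> by auto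
  have first_order: "(g q - y) \<bullet> (z - q) \<ge> 0" if z: "z \<in> closure \<Omega>" for z
  proof (rule ccontr)
    assume neg: "\<not> (g q - y) \<bullet> (z - q) \<ge> 0"
    define k where "k = (\<lambda>s. f (q + s *\<^sub>R (z - q)) - y \<bullet> (q + s *\<^sub>R (z - q)))"
    have "((\<lambda>s. q + s *\<^sub>R (z - q)) has_derivative (\<lambda>v. v *\<^sub>R (z - q))) (at 0)"
      by (auto intro!: derivative_eq_intros)
    moreover have "((\<lambda>z. f z - y \<bullet> z) has_derivative (\<lambda>v. (g q - y) \<bullet> v)) (at (q + 0 *\<^sub>R (z - q)))"
      using f[OF q] by (auto intro!: derivative_eq_intros simp: inner_diff_left)
    ultimately have "(k has_derivative (\<lambda>v. (g q - y) \<bullet> (v *\<^sub>R (z - q)))) (at 0)"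
      unfolding k_def by (rule has_derivative_compose)
    then have "DERIV k 0 :> (g q - y) \<bullet> (z - q)"
      unfolding has_field_derivative_def by (rule has_derivative_eq_rhs) (auto simp: fun_eq_iff)
    then obtain d where d: "d > 0" "\<And>h. 0 < h \<Longrightarrow> h < d \<Longrightarrow> k (0 + h) < k 0"
      using DERIV_neg_dec_right[of k "(g q - y) \<bullet> (z - q)" 0] neg by (metis not_le)
    define h where "h = min (d / 2) 1"
    have h: "0 < h" "h < d" "h \<le> 1" using d by (auto simp: h_def)
    have "q + h *\<^sub>R (z - q) \<in> closure \<Omega>"
      using convexD_alt[OF cl(1) q z, of h] h by (simp add: algebra_simps)
    from min[OF this] d(2)[OF h(1,2)] show False by (simp add: k_def)
  qed
  have "q \<in> \<Omega>"
    using no first_order q \<Omega> by (auto simp: frontier_def interior_open)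
  moreover have "g q = y"
  proof (rule ccontr)
    assume "g q \<noteq> y"
    obtain e where e: "e > 0" "ball q e \<subseteq> \<Omega>"
      using \<Omega>(1) \<open>q \<in> \<Omega>\<close> open_contains_ball by blast
    \<comment> \<open>In the interior every direction is admissible; the inequality is tested on a
      step against \<open>g q - y\<close>, short enough to stay in the ball.\<close>
    define s where "s = e / (2 * norm (g q - y))"
    have s: "s > 0" using e \<open>g q \<noteq> y\<close> by (simp add: s_def)
    have "norm (s *\<^sub>R (g q - y)) < e"
      using e \<open>g q \<noteq> y\<close> by (simp add: s_def)
    then have "q - s *\<^sub>R (g q - y) \<in> closure \<Omega>"
      using e closure_subset by (intro subsetD[OF closure_subset] subsetD[OF e(2)]) (simp add: dist_norm)
    from first_order[OF this] have "s * ((g q - y) \<bullet> (g q - y)) \<le> 0"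
      by simp
    moreover have "(g q - y) \<bullet> (g q - y) > 0" using \<open>g q \<noteq> y\<close> by simp
    ultimately show False using s by (simp add: mult_le_0_iff)
  qed
  ultimately show "y \<in> g ` \<Omega>" by blast
qed

text \<open>\<open>pos_def\<close> does not include symmetry, so no diagonalisation is used: the
  segment from the identity to \<open>A\<close> consists of positive definite, hence invertible,
  matrices, and the determinant cannot change sign along it.\<close>

lemma pos_def_det_pos:
  fixes A :: "real^'m::finite^'m"
  assumes "pos_def A"
  shows "det A > 0"
proof -
  define B where "B s = (1 - s) *\<^sub>R mat 1 + s *\<^sub>R A" for s :: real
  have nz: "det (B s) \<noteq> 0" if "s \<in> {0..1}" for s
  proof
    assume "det (B s) = 0"
    then have "\<not> invertible (B s)" by (simp add: invertible_det_nz)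
    then obtain v where v: "v \<noteq> 0" "B s *v v = 0"
      by (metis invertible_left_inverse matrix_left_invertible_ker)
    have "v \<bullet> (B s *v v) = (1 - s) * (v \<bullet> v) + s * (v \<bullet> (A *v v))"
      by (simp add: B_def matrix_vector_mult_add_rdistrib scaleR_matrix_vector_assoc[symmetric] inner_add_right)
    moreover have "v \<bullet> v > 0" "v \<bullet> (A *v v) > 0"
      using v assms by (auto simp: pos_def_def)
    ultimately have "v \<bullet> (B s *v v) > 0"
      using that by (cases "s = 0") (auto intro!: add_nonneg_pos)
    with v show False by simp
  qed
  have "continuous_on {0..1} (\<lambda>s. det (B s))"
    unfolding B_def det_def by (intro continuous_intros)
  moreover have "det (B 0) = 1" "det (B 1) = det A"
    by (simp_all add: B_def)
  ultimately show ?thesis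
    using IVT2'[of "\<lambda>s. det (B s)" 1 0 0] nz by (cases "det A \<le> 0") auto
qed

section \<open>Integral inequalities\<close>

text \<open>This is the tangent line at 1 to the concave power, with its contact point. For
  \<open>y = a powr (1 / real m)\<close>, Bernoulli's inequality applied to
  \<open>y\<^sup>2 - 1\<close> with exponent \<open>k\<close> leaves the surplus
  \<open>real k * (y - 1)\<^sup>2\<close>, which settles the equality case; this is where the even
  dimension is exploited.\<close>

lemma powr_inverse_even_tangent:
  fixes a :: real
  assumes a: "a > 0" and k: "k > 0" and m: "m = 2 * k"
  shows "a powr (1 / real m) \<le> 1 + (a - 1) / real m"
    and "a powr (1 / real m) = 1 + (a - 1) / real m \<Longrightarrow> a = 1"
proof -
  define y where "y = a powr (1 / real m)"
  have y: "y > 0" using a by (simp add: y_def)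
  have "y ^ m = y powr real m"
    using y by (simp add: powr_realpow)
  also have "\<dots> = a"
    using a k m by (simp add: y_def powr_powr)
  finally have ya: "(y\<^sup>2) ^ k = a"
    by (simp add: m power_mult)
  have "1 + real k * (y\<^sup>2 - 1) \<le> (1 + (y\<^sup>2 - 1)) ^ k"
    by (rule Bernoulli_inequality) simp
  then have "1 + real k * (y\<^sup>2 - 1) \<le> a"
    using ya by simp
  moreover have "1 + real k * (y\<^sup>2 - 1) = 1 + real m * (y - 1) + real k * (y - 1)\<^sup>2"
    by (simp add: m power2_eq_square algebra_simps)
  ultimately have le: "real m * (y - 1) + real k * (y - 1)\<^sup>2 \<le> a - 1" by simp
  have m0: "real m > 0" using k m by simp
  have "real m * (y - 1) \<le> a - 1"
    using le by (smt (verit) mult_nonneg_nonneg of_nat_0_le_iff zero_le_power2)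
  then show "a powr (1 / real m) \<le> 1 + (a - 1) / real m"
    using m0 by (simp add: y_def[symmetric] field_simps)
  assume "a powr (1 / real m) = 1 + (a - 1) / real m"
  then have "real m * (y - 1) = a - 1"
    using m0 by (simp add: y_def[symmetric] field_simps)
  with le k have "(y - 1)\<^sup>2 \<le> 0"
    by (simp add: mult_le_0_iff)
  then have "y = 1" by simp
  with ya show "a = 1" by simp
qed

lemma integrable_on_open_continuous_closure:
  fixes f :: "'a::euclidean_space \<Rightarrow> real"
  assumes S: "open S" "bounded S" and f: "continuous_on (closure S) f"
  shows "f integrable_on S"
proof -
  have lm: "S \<in> lmeasurable" using S by (intro lmeasurable_open)
  have "bounded (f ` closure S)"
    using S f by (intro compact_imp_bounded compact_continuous_image) (auto simp: compact_closure)
  then obtain B where B: "\<And>x. x \<in> closure S \<Longrightarrow> norm (f x) \<le> B"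
    unfolding bounded_iff by auto
  show ?thesis
  proof (rule measurable_bounded_by_integrable_imp_integrable)
    show "f \<in> borel_measurable (lebesgue_on S)"
      using lm f closure_subset
      by (intro continuous_imp_measurable_on_sets_lebesgue) (auto intro: continuous_on_subset)
    show "(\<lambda>_. B) integrable_on S" using lm by (rule integrable_on_const)
    show "norm (f x) \<le> B" if "x \<in> S" for x using B that closure_subset by blast
  qed (use lm in auto)
qed

lemma integral_const_lmeasurable:
  assumes "S \<in> lmeasurable"
  shows "integral S (\<lambda>_. c::real) = c * measure lebesgue S"
proof -
  have "((\<lambda>_. 1::real) has_integral measure lebesgue S) S"
    using assms by (metis has_integral_iff lmeasurable_iff_integrable_on lmeasure_integral)
  from has_integral_mult_right[OF this, of c] show ?thesis
    by (simp add: integral_unique)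
qed

lemma measure_lebesgue_open_pos:
  fixes S :: "'a::euclidean_space set"
  assumes "open S" "bounded S" "S \<noteq> {}"
  shows "measure lebesgue S > 0"
  using assms open_not_negligible[of S] lmeasurable_open[of S] negligible_iff_measure0[of S]
  by (metis measure_nonneg less_eq_real_def)

lemma integral_nonneg_eq_0_open:
  fixes f :: "'a::euclidean_space \<Rightarrow> real"
  assumes S: "open S" and f: "continuous_on S f" "\<And>x. x \<in> S \<Longrightarrow> 0 \<le> f x"
    and int: "f integrable_on S" "integral S f = 0" and x: "x \<in> S"
  shows "f x = 0"
proof -
  obtain a b where ab: "x \<in> box a b" "cbox a b \<subseteq> S"
    using open_contains_cbox[OF S x] by (metis)
  have cf: "continuous_on (cbox a b) f" using f(1) ab(2) by (rule continuous_on_subset)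
  have fi: "f integrable_on cbox a b" using cf by (rule integrable_continuous)
  have "integral (cbox a b) f \<le> integral S f"
    using ab fi int f by (intro integral_subset_le) auto
  moreover have "integral (cbox a b) f \<ge> 0"
    using fi f ab by (intro integral_nonneg) auto
  ultimately have "(f has_integral 0) (cbox a b)"
    using fi int by (simp add: has_integral_iff)
  then show ?thesis
    using ab cf f box_subset_cbox[of a b] by (intro has_integral_0_cbox_imp_0[of a b f]) auto
qed

lemma integral_pos_open:
  fixes f :: "'a::euclidean_space \<Rightarrow> real"
  assumes S: "open S" "bounded S" "S \<noteq> {}" and f: "continuous_on (closure S) f" "\<And>x. x \<in> closure S \<Longrightarrow> 0 < f x"
  shows "integral S f > 0"
proof -
  have int: "f integrable_on S" by (rule integrable_on_open_continuous_closure[OF S(1,2) f(1)])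
  obtain x where "x \<in> S" using S by blast
  have "integral S f \<noteq> 0"
    using integral_nonneg_eq_0_open[OF S(1) continuous_on_subset[OF f(1) closure_subset] _ int _ \<open>x \<in> S\<close>]
      f(2) closure_subset[of S] \<open>x \<in> S\<close> by (metis less_imp_le order_less_irrefl subsetD)
  moreover have "integral S f \<ge> 0"
    using int f(2) closure_subset by (intro integral_nonneg) (auto intro: less_imp_le)
  ultimately show ?thesis by simp
qed

text \<open>Let \<open>A\<close> be the mean of \<open>f\<close> and \<open>T\<close> the tangent
  line of the power at \<open>A\<close>, evaluated along \<open>f\<close>. Then \<open>T\<close>
  dominates the power of \<open>f\<close> pointwise, and the mean of \<open>T\<close> is exactly the
  right-hand side. In the equality case the continuous nonnegative gap has integral zero, so it
  vanishes on \<open>S\<close>, and contact with the tangent occurs only at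
  \<open>A\<close>.\<close>

lemma jensen_powr_mean:
  fixes f :: "'a::euclidean_space \<Rightarrow> real"
  assumes S: "open S" "bounded S" "S \<noteq> {}"
    and f: "continuous_on (closure S) f" "\<And>x. x \<in> closure S \<Longrightarrow> 0 < f x"
    and k: "k > 0" and m: "m = 2 * k"
  shows "(1 / measure lebesgue S) * integral S (\<lambda>x. f x powr (1 / real m))
           \<le> measure lebesgue S powr (- 1 / real m) * integral S f powr (1 / real m)"
    and "(1 / measure lebesgue S) * integral S (\<lambda>x. f x powr (1 / real m))
           = measure lebesgue S powr (- 1 / real m) * integral S f powr (1 / real m) \<Longrightarrow> x \<in> S \<Longrightarrow> f x = integral S f / measure lebesgue S"
proof -
  let ?lhs = "(1 / measure lebesgue S) * integral S (\<lambda>x. f x powr (1 / real m))"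
  let ?rhs = "measure lebesgue S powr (- 1 / real m) * integral S f powr (1 / real m)"
  define V where "V = measure lebesgue S"
  define A where "A = integral S f / V"
  let ?\<alpha> = "1 / real m"
  have V: "V > 0" unfolding V_def by (rule measure_lebesgue_open_pos[OF S])
  have I: "integral S f > 0" by (rule integral_pos_open[OF S f])
  have A: "A > 0" using V I by (simp add: A_def)
  have lm: "S \<in> lmeasurable" using S by (intro lmeasurable_open)
  have intf: "f integrable_on S" by (rule integrable_on_open_continuous_closure[OF S(1,2) f(1)])
  define T where "T x = A powr ?\<alpha> * (1 + (f x / A - 1) / real m)" for x
  have powr_eq: "f x powr ?\<alpha> = A powr ?\<alpha> * (f x / A) powr ?\<alpha>" if "x \<in> closure S" for x
    using f(2)[OF that] A by (simp add: powr_divide)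
  have le: "f x powr ?\<alpha> \<le> T x" if "x \<in> closure S" for x
    unfolding powr_eq[OF that] T_def
    using f(2)[OF that] A by (intro mult_left_mono powr_inverse_even_tangent(1)[OF _ k m]) auto
  have eqD: "f x = A" if "x \<in> closure S" "f x powr ?\<alpha> = T x" for x
  proof -
    have "(f x / A) powr ?\<alpha> = 1 + (f x / A - 1) / real m"
      using that(2) A unfolding powr_eq[OF that(1)] T_def by simp
    then have "f x / A = 1"
      using f(2)[OF that(1)] A by (intro powr_inverse_even_tangent(2)[OF _ k m]) auto
    with A show ?thesis by simp
  qed
  have cp: "continuous_on (closure S) (\<lambda>x. f x powr ?\<alpha>)"
    using f by (intro continuous_on_powr continuous_on_const) (auto simp: less_imp_neq[THEN not_sym])
  have ip: "(\<lambda>x. f x powr ?\<alpha>) integrable_on S"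
    by (rule integrable_on_open_continuous_closure[OF S(1,2) cp])
  have cT: "continuous_on (closure S) T"
    unfolding T_def using A k m by (intro continuous_intros f(1)) auto
  have iT: "T integrable_on S"
    by (rule integrable_on_open_continuous_closure[OF S(1,2) cT])
  have "integral S T = A powr ?\<alpha> * V"
  proof -
    have "((\<lambda>x. A powr ?\<alpha> * (1 - 1 / real m) + A powr ?\<alpha> / (A * real m) * f x) has_integral
        (A powr ?\<alpha> * (1 - 1 / real m) * V + A powr ?\<alpha> / (A * real m) * integral S f)) S"
      using has_integral_add[OF integrable_integral[OF integrable_on_const[OF lm]] has_integral_mult_right[OF integrable_integral[OF intf]]]
      unfolding integral_const_lmeasurable[OF lm] V_def by blast
    moreover have "T = (\<lambda>x. A powr ?\<alpha> * (1 - 1 / real m) + A powr ?\<alpha> / (A * real m) * f x)"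
      using A k m by (auto simp: T_def fun_eq_iff field_simps)
    moreover have "integral S f = A * V" using V by (simp add: A_def)
    ultimately have "integral S T = A powr ?\<alpha> * (1 - 1 / real m) * V + A powr ?\<alpha> / (A * real m) * (A * V)"
      by (simp add: integral_unique)
    also have "\<dots> = A powr ?\<alpha> * V"
      using A k m by (simp add: field_simps)
    finally show ?thesis .
  qed
  moreover have "A powr ?\<alpha> = V powr (- 1 / real m) * integral S f powr ?\<alpha>"
    using V I by (simp add: A_def powr_divide powr_minus_divide)
  ultimately have rhs: "V powr (- 1 / real m) * integral S f powr ?\<alpha> = (1 / V) * integral S T"
    using V by simp
  have "integral S (\<lambda>x. f x powr ?\<alpha>) \<le> integral S T"
    using ip iT le closure_subset by (intro integral_le) auto
  then show "?lhs \<le> ?rhs"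
    unfolding V_def[symmetric] unfolding rhs using V by (intro mult_left_mono) auto
  assume eq: "?lhs = ?rhs" and x: "x \<in> S"
  have "integral S (\<lambda>x. T x - f x powr ?\<alpha>) = 0"
    using eq V unfolding V_def[symmetric] unfolding rhs by (simp add: integral_diff[OF iT ip])
  moreover have "continuous_on S (\<lambda>x. T x - f x powr ?\<alpha>)"
    using continuous_on_diff[OF cT cp] closure_subset by (rule continuous_on_subset)
  moreover have "0 \<le> T y - f y powr ?\<alpha>" if "y \<in> S" for y
    using le[of y] that closure_subset by auto
  ultimately have "T x - f x powr ?\<alpha> = 0"
    using integral_nonneg_eq_0_open[OF S(1) _ _ integrable_diff[OF iT ip] _ x] by simp
  then show "f x = integral S f / measure lebesgue S"
    using eqD[of x] x closure_subset[of S] by (auto simp: A_def V_def)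
qed

text \<open>Uniform continuity on a compact product gives the estimate. Continuity in time makes the
  integrands of length and volume integrable and allows equality to be drawn at every time rather
  than almost every time.\<close>

lemma continuous_on_integral_param:
  fixes F :: "real \<Rightarrow> 'a::euclidean_space \<Rightarrow> real"
  assumes S: "open S" "bounded S" and T: "compact T"
    and F: "continuous_on (T \<times> closure S) (\<lambda>(t, z). F t z)"
  shows "continuous_on T (\<lambda>t. integral S (F t))"
  unfolding continuous_on_iff
proof (intro ballI allI impI)
  fix t and e :: real assume t: "t \<in> T" and e: "e > 0"
  define V where "V = measure lebesgue S"
  have V: "V \<ge> 0" by (simp add: V_def)
  have lm: "S \<in> lmeasurable" using S by (intro lmeasurable_open)
  have int: "F s integrable_on S" if "s \<in> T" for s
    by (rule integrable_on_open_continuous_closure[OF S continuous_on_slice[OF F that]])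
  have "uniformly_continuous_on (T \<times> closure S) (\<lambda>(t, z). F t z)"
    using S T F by (intro compact_uniformly_continuous compact_Times) (auto simp: compact_closure)
  then obtain d where d: "d > 0" "\<And>p q. p \<in> T \<times> closure S \<Longrightarrow> q \<in> T \<times> closure S \<Longrightarrow> dist q p < d \<Longrightarrow>
      dist ((\<lambda>(t, z). F t z) q) ((\<lambda>(t, z). F t z) p) < e / (V + 1)"
    using e V unfolding uniformly_continuous_on_def by (metis add_nonneg_pos divide_pos_pos zero_less_one)
  have "dist (integral S (F s)) (integral S (F t)) < e" if s: "s \<in> T" "dist s t < d" for s
  proof -
    have "norm (integral S (\<lambda>z. F s z - F t z)) \<le> integral S (\<lambda>_. e / (V + 1))"
    proof (rule integral_norm_bound_integral)
      show "(\<lambda>z. F s z - F t z) integrable_on S" by (intro integrable_diff int s t)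
      show "(\<lambda>_. e / (V + 1)) integrable_on S" by (rule integrable_on_const[OF lm])
      fix z assume z: "z \<in> S"
      have "dist (s, z) (t, z) < d" using s by (simp add: dist_Pair_Pair)
      then show "norm (F s z - F t z) \<le> e / (V + 1)"
        using d(2)[of "(t, z)" "(s, z)"] s t z closure_subset by (force simp: dist_norm)
    qed
    also have "\<dots> = e * (V / (V + 1))"
      by (simp add: integral_const_lmeasurable[OF lm] V_def)
    also have "\<dots> < e * 1"
      using e V by (intro mult_strict_left_mono) auto
    finally show ?thesis
      by (simp add: dist_norm integral_diff[OF int[OF s(1)] int[OF t]])
  qed
  with d(1) show "\<exists>d>0. \<forall>s\<in>T. dist s t < d \<longrightarrow> dist (integral S (F s)) (integral S (F t)) < e"
    by blast
qed

section \<open>Comparison of length and volume\<close>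

context hamiltonian_path
begin

lemma det_hess_pos: "t \<in> {0..1} \<Longrightarrow> z \<in> closure \<Omega> \<Longrightarrow> det (hess (H t) z) > 0"
  using path unfolding positive_path_def by (intro pos_def_det_pos) blast

lemma continuous_on_det_hess: "continuous_on ({0..1} \<times> closure \<Omega>) (\<lambda>(t, z). det (hess (H t) z))"
proof -
  have "continuous_on ({0..1} \<times> closure \<Omega>) (\<lambda>p. det ((\<lambda>(t, z). hess (H t) z) p))"
    unfolding det_def by (intro continuous_intros continuous_grad_hess(2))
  then show ?thesis by (simp add: case_prod_beta')
qed

lemma measure_grad_image:
  assumes t: "t \<in> {0..1}"
  shows "measure lebesgue (grad (H t) ` \<Omega>) = integral \<Omega> (\<lambda>z. det (hess (H t) z))"
proof -
  note \<Omega> = unif_convex_domainD[OF dom]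
  have pd: "pos_def (hess (H t) z)" if "z \<in> closure \<Omega>" for z
    using path t that unfolding positive_path_def by blast
  \<comment> \<open>\<open>'n bit0\<close> serves as a concrete well-ordered index type with twice
    as many elements as \<open>'n\<close>; any bijection will do.\<close>
  have "CARD('n bit0) = CARD('n + 'n)" by simp
  then obtain e :: "'n bit0 \<Rightarrow> 'n + 'n" where e: "bij e"
    using finite_same_card_bij[of "UNIV :: 'n bit0 set" "UNIV :: ('n + 'n) set"] by auto
  have abs: "\<bar>det (matrix (\<lambda>v. hess (H t) z *v v))\<bar> = det (hess (H t) z)" if "z \<in> \<Omega>" for z
    using det_hess_pos[OF t, of z] that closure_subset[of \<Omega>] by auto
  have "(\<lambda>z. det (hess (H t) z)) integrable_on \<Omega>"
    using \<Omega> t by (intro integrable_on_open_continuous_closure continuous_on_slice[OF continuous_on_det_hess])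
  then have int: "(\<lambda>z. \<bar>det (matrix (\<lambda>v. hess (H t) z *v v))\<bar>) integrable_on \<Omega>"
    using abs by (metis (mono_tags, lifting) integrable_cong)
  have "inj_on (grad (H t)) \<Omega>"
  proof (rule inj_onI, rule ccontr)
    fix x y assume xy: "x \<in> \<Omega>" "y \<in> \<Omega>" "grad (H t) x = grad (H t) y" "x \<noteq> y"
    have "(grad (H t) x - grad (H t) y) \<bullet> (x - y) > 0"
      using xy closure_subset[of \<Omega>]
      by (intro pos_def_derivative_strict_mono[OF \<Omega>(5) der_grad_hess(2)[OF t] pd]) auto
    with xy show False by simp
  qed
  then have "measure lebesgue (grad (H t) ` \<Omega>) = integral \<Omega> (\<lambda>z. \<bar>det (matrix (\<lambda>v. hess (H t) z *v v))\<bar>)"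
    using int closure_subset[of \<Omega>]
    by (intro measure_differentiable_image_eq_reindex[OF e \<Omega>(1)] der_grad_hess(2)[OF t]) auto
  also have "\<dots> = integral \<Omega> (\<lambda>z. det (hess (H t) z))"
    using abs by (rule integral_cong)
  finally show ?thesis .
qed

text \<open>Both quantities are computed here from one Hamiltonian; independence of the choices is a
  separate matter. The spatial inequality holds at each time and is then integrated. The last part
  assumes a constant determinant on \<Omega> only, which is what
  \<open>hess_generator_unique\<close> can supply.\<close>

lemma length_volume_comparison:
  fixes c :: "real \<Rightarrow> real"
  assumes ne: "\<Omega> \<noteq> {}"
  defines "len \<equiv> (1 / measure lebesgue \<Omega>) *
       integral {0..1} (\<lambda>t. integral \<Omega> (\<lambda>z. det (hess (H t) z) powr (1 / real CARD('n + 'n))))"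
    and "vol \<equiv> measure lebesgue \<Omega> powr (- 1 / real CARD('n + 'n)) *
       integral {0..1} (\<lambda>t. measure lebesgue (grad (H t) ` \<Omega>) powr (1 / real CARD('n + 'n)))"
  shows "len \<le> vol"
    and "len = vol \<Longrightarrow> \<exists>c. \<forall>t\<in>{0..1}. c t > (0::real) \<and> (\<forall>z\<in>closure \<Omega>. det (hess (H t) z) = c t)"
    and "\<forall>t\<in>{0..1}. c t > 0 \<and> (\<forall>z\<in>\<Omega>. det (hess (H t) z) = c t) \<Longrightarrow> len = vol"
proof -
  note \<Omega> = unif_convex_domainD[OF dom]
  define m where "m = CARD('n + 'n)"
  define V where "V = measure lebesgue \<Omega>"
  define D where "D t z = det (hess (H t) z)" for t z
  define I where "I t = integral \<Omega> (D t)" for t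
  define a where "a t = (1 / V) * integral \<Omega> (\<lambda>z. D t z powr (1 / real m))" for t
  define b where "b t = V powr (- 1 / real m) * I t powr (1 / real m)" for t
  have m: "m = 2 * CARD('n)" and k: "CARD('n) > 0" by (simp_all add: m_def)
  have V: "V > 0" unfolding V_def by (rule measure_lebesgue_open_pos[OF \<Omega>(1,2) ne])
  have lm: "\<Omega> \<in> lmeasurable" using \<Omega> by (intro lmeasurable_open)
  have Dpos: "D t z > 0" if "t \<in> {0..1}" "z \<in> closure \<Omega>" for t z
    unfolding D_def by (rule det_hess_pos[OF that])
  have contD: "continuous_on ({0..1} \<times> closure \<Omega>) (\<lambda>(t, z). D t z)"
    unfolding D_def by (rule continuous_on_det_hess)
  have contDt: "continuous_on (closure \<Omega>) (D t)" if "t \<in> {0..1}" for t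
    using contD that by (rule continuous_on_slice)
  have contDp: "continuous_on ({0..1} \<times> closure \<Omega>) (\<lambda>(t, z). D t z powr (1 / real m))"
  proof -
    have "continuous_on ({0..1} \<times> closure \<Omega>) (\<lambda>p. (\<lambda>(t, z). D t z) p powr (1 / real m))"
      using Dpos by (intro continuous_on_powr contD continuous_on_const) (force dest: less_imp_neq)
    then show ?thesis by (simp add: case_prod_beta')
  qed
  have Ipos: "I t > 0" if "t \<in> {0..1}" for t
    unfolding I_def by (rule integral_pos_open[OF \<Omega>(1,2) ne contDt[OF that] Dpos[OF that]])
  have "continuous_on {0..1} I"
    unfolding I_def by (rule continuous_on_integral_param[OF \<Omega>(1,2) _ contD]) simp
  then have cb: "continuous_on {0..1} b"
    unfolding b_def using Ipos V
    by (intro continuous_on_mult continuous_on_powr continuous_on_const) (auto simp: less_imp_neq[THEN not_sym])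
  have ca: "continuous_on {0..1} a"
    unfolding a_def using continuous_on_integral_param[OF \<Omega>(1,2) _ contDp]
    by (intro continuous_on_mult continuous_on_const) simp
  have ia: "a integrable_on {0..1}" and ib: "b integrable_on {0..1}"
    using ca cb by (auto intro: integrable_continuous_interval)
  have len: "len = integral {0..1} a"
    unfolding len_def a_def V_def D_def m_def by (rule integral_mult_right[symmetric])
  have "vol = V powr (- 1 / real m) * integral {0..1} (\<lambda>t. I t powr (1 / real m))"
    unfolding vol_def V_def m_def I_def D_def
    by (intro arg_cong2[where f="(*)"] refl integral_cong) (simp add: measure_grad_image)
  then have vol: "vol = integral {0..1} b"
    unfolding b_def by simp
  have ab: "a t \<le> b t" if "t \<in> {0..1}" for t
    unfolding a_def b_def I_def V_def
    by (rule jensen_powr_mean(1)[OF \<Omega>(1,2) ne contDt[OF that] Dpos[OF that] k m])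
  show "len \<le> vol"
    unfolding len vol using ia ib ab by (rule integral_le)
  show "\<exists>c. \<forall>t\<in>{0..1}. c t > (0::real) \<and> (\<forall>z\<in>closure \<Omega>. det (hess (H t) z) = c t)" if eq: "len = vol"
  proof (intro exI ballI conjI)
    fix t :: real assume t: "t \<in> {0..1}"
    show "I t / V > 0" using Ipos[OF t] V by simp
    \<comment> \<open>A continuous nonnegative function of time with integral zero vanishes at every
      time, so the equality case of Jensen is available for each \<open>t\<close>.\<close>
    have "integral {0..1} (\<lambda>t. b t - a t) = 0"
      using eq unfolding len vol by (simp add: integral_diff[OF ib ia])
    then have "b t - a t = 0"
      using t ab by (subst (asm) integral_eq_0_iff) (auto intro: continuous_on_diff ca cb)
    then have eqt: "a t = b t" by simp
    have "D t z = I t / V" if "z \<in> \<Omega>" for z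
      unfolding I_def V_def
      by (rule jensen_powr_mean(2)[OF \<Omega>(1,2) ne contDt[OF t] Dpos[OF t] k m _ that])
        (use eqt in \<open>simp_all add: a_def b_def I_def V_def\<close>)
    then show "det (hess (H t) z) = I t / V" if "z \<in> closure \<Omega>" for z
      using continuous_constant_on_closure[OF contDt[OF t] _ that] by (simp add: D_def)
  qed
  show "len = vol" if c: "\<forall>t\<in>{0..1}. c t > 0 \<and> (\<forall>z\<in>\<Omega>. det (hess (H t) z) = c t)"
    unfolding len vol
  proof (rule integral_cong)
    fix t :: real assume t: "t \<in> {0..1}"
    have c0: "c t > 0" using c t by blast
    have "I t = integral \<Omega> (\<lambda>z. c t)"
      unfolding I_def using c t by (intro integral_cong) (simp add: D_def)
    then have I: "I t = c t * V" by (simp add: integral_const_lmeasurable[OF lm] V_def)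
    have "integral \<Omega> (\<lambda>z. D t z powr (1 / real m)) = integral \<Omega> (\<lambda>z. c t powr (1 / real m))"
      using c t by (intro integral_cong) (simp add: D_def)
    then have "a t = c t powr (1 / real m)"
      using V by (simp add: a_def integral_const_lmeasurable[OF lm] V_def[symmetric])
    also have "\<dots> = b t"
      using V c0 by (simp add: b_def I powr_mult powr_minus_divide)
    finally show "a t = b t" .
  qed
qed

end

section \<open>Independence of the chosen Hamiltonian\<close>

lemma generators_agree_along_flow:
  assumes H: "hamiltonian_path \<Omega> \<phi> H" and H': "hamiltonian_path \<Omega> \<phi>' H'"
    and z: "z \<in> closure \<Omega>" and eq: "\<And>s. s \<in> {0..1} \<Longrightarrow> \<phi> s z = \<phi>' s z" and t: "t \<in> {0..1}"
  shows "grad (H t) (\<phi> t z) = grad (H' t) (\<phi> t z)"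
proof -
  have "((\<lambda>s. \<phi> s z) has_vector_derivative J0 (grad (H' t) (\<phi>' t z))) (at t within {0..1})"
    by (rule has_vector_derivative_transform[OF t eq hamiltonian_path.flow_derivative[OF H' t z]])
  \<comment> \<open>At the endpoints 0 and 1 the derivatives are one-sided, and they are still
    unique because no point of the interval is isolated.\<close>
  moreover have "at t within {0..1} \<noteq> bot"
    using t by (cases "t = 1") (auto simp: trivial_limit_within islimpt_Icc)
  ultimately have "J0 (grad (H t) (\<phi> t z)) = J0 (grad (H' t) (\<phi>' t z))"
    using vector_derivative_unique_within hamiltonian_path.flow_derivative[OF H t z] by blast
  then show ?thesis
    using inj_J0 eq[OF t] by (metis injD)
qed

text \<open>The two paths may differ inside \<Omega>. Agreement of velocities along boundary
  trajectories, which cover the frontier, fixes the gradients there, and the criterion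
  \<open>gradient_image_iff_frontier\<close> mentions no other values of the gradient. This makes
  \<open>volV\<close> independent of its choice.\<close>

lemma gradient_image_boundary_determined:
  assumes H: "hamiltonian_path \<Omega> \<phi> H" and H': "hamiltonian_path \<Omega> \<phi>' H'" and ne: "\<Omega> \<noteq> {}"
    and eq: "\<And>s z. s \<in> {0..1} \<Longrightarrow> z \<in> frontier \<Omega> \<Longrightarrow> \<phi> s z = \<phi>' s z" and t: "t \<in> {0..1}"
  shows "grad (H t) ` \<Omega> = grad (H' t) ` \<Omega>"
proof -
  interpret A: hamiltonian_path \<Omega> \<phi> H by (rule H)
  interpret B: hamiltonian_path \<Omega> \<phi>' H' by (rule H')
  note \<Omega> = unif_convex_domainD[OF A.dom]
  have on_frontier: "grad (H t) p = grad (H' t) p" if p: "p \<in> frontier \<Omega>" for p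
  proof -
    obtain z where z: "z \<in> frontier \<Omega>" "p = \<phi> t z"
      using A.flow_frontier_image[OF t] p by blast
    then have "z \<in> closure \<Omega>" by (simp add: frontier_def)
    from generators_agree_along_flow[OF H H' this eq[OF _ z(1)] t] z show ?thesis by simp
  qed
  have pd: "pos_def (hess (H t) z)" "pos_def (hess (H' t) z)" if "z \<in> closure \<Omega>" for z
    using A.path B.path t that unfolding positive_path_def by blast+
  have "y \<in> grad (H t) ` \<Omega> \<longleftrightarrow> y \<in> grad (H' t) ` \<Omega>" for y
  proof -
    have "y \<in> grad (H t) ` \<Omega> \<longleftrightarrow> \<not> (\<exists>p\<in>frontier \<Omega>. \<forall>z\<in>closure \<Omega>. (grad (H t) p - y) \<bullet> (z - p) \<ge> 0)"
      by (rule gradient_image_iff_frontier[OF \<Omega>(1-3) ne A.der_grad_hess[OF t] pd(1)])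
    also have "\<dots> \<longleftrightarrow> \<not> (\<exists>p\<in>frontier \<Omega>. \<forall>z\<in>closure \<Omega>. (grad (H' t) p - y) \<bullet> (z - p) \<ge> 0)"
      using on_frontier by simp
    also have "\<dots> \<longleftrightarrow> y \<in> grad (H' t) ` \<Omega>"
      by (rule gradient_image_iff_frontier[OF \<Omega>(1-3) ne B.der_grad_hess[OF t] pd(2), symmetric])
    finally show ?thesis .
  qed
  then show ?thesis by blast
qed

text \<open>Since \<open>\<phi> t\<close> is onto, the common velocities determine the gradient at
  every point of \<Omega>. As \<open>hess\<close> is a full derivative, the gradients must agree on
  an open neighbourhood, which is at hand for \<open>z\<close> in \<Omega>.\<close>

lemma hess_generator_unique:
  assumes H: "hamiltonian_path \<Omega> \<phi> H" and H': "hamiltonian_path \<Omega> \<phi> H'"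
    and t: "t \<in> {0..1}" and z: "z \<in> \<Omega>"
  shows "hess (H t) z = hess (H' t) z"
proof -
  interpret A: hamiltonian_path \<Omega> \<phi> H by (rule H)
  have eq: "grad (H t) p = grad (H' t) p" if "p \<in> \<Omega>" for p
  proof -
    have "p \<in> \<phi> t ` closure \<Omega>"
      unfolding A.flow_closure_image[OF t] using that closure_subset by blast
    then obtain q where "q \<in> closure \<Omega>" "p = \<phi> t q" by blast
    with generators_agree_along_flow[OF H H' _ refl t] show ?thesis by simp
  qed
  have "(grad (H t) has_derivative (\<lambda>v. hess (H t) z *v v)) (at z)"
    using A.der_grad_hess(2)[OF t] z closure_subset by blast
  then have "(grad (H' t) has_derivative (\<lambda>v. hess (H t) z *v v)) (at z)"
    by (rule has_derivative_transform_within_open[OF _ unif_convex_domainD(1)[OF A.dom] z eq])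
  from frechet_derivative_at[OF this] have "frechet_derivative (grad (H' t)) (at z) = (\<lambda>v. hess (H t) z *v v)"
    by (rule sym)
  then show ?thesis
    by (simp add: hess_def[of "H' t"])
qed

theorem theorem9:
  fixes \<Omega> :: "(real^('n::finite + 'n)) set"
    and \<psi> \<phi> :: "real \<Rightarrow> real^('n + 'n) \<Rightarrow> real^('n + 'n)"
  assumes "unif_convex_domain \<Omega>"
    and "extendable \<Omega> \<psi>"
    and "\<exists>H. positive_path \<Omega> \<phi> H"
    and "extends_path \<Omega> \<phi> \<psi>"
  shows "lengthG \<Omega> \<phi> \<le> volV \<Omega> \<psi> \<and>
         (lengthG \<Omega> \<phi> = volV \<Omega> \<psi> \<longleftrightarrow>
           (\<exists>H c. positive_path \<Omega> \<phi> H \<and>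
              (\<forall>t\<in>{0..1}. c t > (0::real) \<and> (\<forall>z\<in>closure \<Omega>. det (hess (H t) z) = c t))))"
proof (cases "\<Omega> = {}")
  \<comment> \<open>The empty set satisfies \<open>unif_convex_domain\<close>. Both numbers are then
    0 by the conventions for division by zero and for \<open>powr\<close> at base 0, and the
    equation holds vacuously with constant 1.\<close>
  case True
  then have "lengthG \<Omega> \<phi> = 0" "volV \<Omega> \<psi> = 0"
    by (simp_all add: lengthG_def volV_def)
  moreover have "\<exists>H c. positive_path \<Omega> \<phi> H \<and>
      (\<forall>t\<in>{0..1::real}. c t > (0::real) \<and> (\<forall>z\<in>closure \<Omega>. det (hess (H t) z) = c t))"
    using assms(3) True by (auto intro!: exI[of _ "\<lambda>_. 1"])
  ultimately show ?thesis by simp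
next
  case ne: False
  define H where "H = (SOME H. positive_path \<Omega> \<phi> H)"
  define H' where "H' = (SOME H. \<exists>\<phi>. positive_path \<Omega> \<phi> H \<and> extends_path \<Omega> \<phi> \<psi>)"
  have pH: "positive_path \<Omega> \<phi> H"
    unfolding H_def using assms(3) by (rule someI_ex)
  have "\<exists>H. \<exists>\<phi>. positive_path \<Omega> \<phi> H \<and> extends_path \<Omega> \<phi> \<psi>"
    using assms(2) unfolding extendable_def by blast
  then have "\<exists>\<phi>. positive_path \<Omega> \<phi> H' \<and> extends_path \<Omega> \<phi> \<psi>"
    unfolding H'_def by (rule someI_ex)
  then obtain \<phi>' where \<phi>': "positive_path \<Omega> \<phi>' H'" "extends_path \<Omega> \<phi>' \<psi>" by blast
  have A: "hamiltonian_path \<Omega> \<phi> H" and B: "hamiltonian_path \<Omega> \<phi>' H'"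
    using assms(1) pH \<phi>' by (simp_all add: hamiltonian_path_def)
  \<comment> \<open>\<open>H'\<close> may generate a different extension of \<psi>; the shared
    boundary values allow the volume to be rewritten in terms of \<open>H\<close>, so that the
    comparison for a single Hamiltonian applies.\<close>
  have "grad (H' t) ` \<Omega> = grad (H t) ` \<Omega>" if "t \<in> {0..1}" for t
    using assms(4) \<phi>'(2) that unfolding extends_path_def
    by (intro gradient_image_boundary_determined[OF B A ne]) auto
  then have vol: "volV \<Omega> \<psi> = measure lebesgue \<Omega> powr (- 1 / real CARD('n + 'n)) *
       integral {0..1} (\<lambda>t. measure lebesgue (grad (H t) ` \<Omega>) powr (1 / real CARD('n + 'n)))"
    unfolding volV_def Let_def H'_def[symmetric]
    by (intro arg_cong2[where f="(*)"] refl integral_cong) simp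
  have len: "lengthG \<Omega> \<phi> = (1 / measure lebesgue \<Omega>) *
       integral {0..1} (\<lambda>t. integral \<Omega> (\<lambda>z. det (hess (H t) z) powr (1 / real CARD('n + 'n))))"
    unfolding lengthG_def Let_def H_def ..
  note comparison = hamiltonian_path.length_volume_comparison[OF A ne, folded len vol]
  show ?thesis
  proof (intro conjI iffI)
    show "lengthG \<Omega> \<phi> \<le> volV \<Omega> \<psi>" by (rule comparison(1))
    show "\<exists>H c. positive_path \<Omega> \<phi> H \<and>
        (\<forall>t\<in>{0..1}. c t > (0::real) \<and> (\<forall>z\<in>closure \<Omega>. det (hess (H t) z) = c t))"
      if "lengthG \<Omega> \<phi> = volV \<Omega> \<psi>"
      using comparison(2)[OF that] pH by blast
    assume "\<exists>H c. positive_path \<Omega> \<phi> H \<and>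
        (\<forall>t\<in>{0..1}. c t > (0::real) \<and> (\<forall>z\<in>closure \<Omega>. det (hess (H t) z) = c t))"
    then obtain K c where K: "positive_path \<Omega> \<phi> K"
      and c: "\<forall>t\<in>{0..1}. c t > (0::real) \<and> (\<forall>z\<in>closure \<Omega>. det (hess (K t) z) = c t)" by blast
    \<comment> \<open>The given solution \<open>K\<close> need not be the selected \<open>H\<close>,
      but both generate \<phi>, so their Hessians coincide on \<Omega>.\<close>
    have "hamiltonian_path \<Omega> \<phi> K" using assms(1) K by (simp add: hamiltonian_path_def)
    from hess_generator_unique[OF A this] c closure_subset
    have "\<forall>t\<in>{0..1}. c t > 0 \<and> (\<forall>z\<in>\<Omega>. det (hess (H t) z) = c t)"
      by (metis (no_types, lifting) subsetD)
    then show "lengthG \<Omega> \<phi> = volV \<Omega> \<psi>" by (rule comparison(3))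
  qed
qed

end
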